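(* Let $\mathbf{k}$ be a commutative ring with unit. The unitary infinitesimal $(\backslash,\vee)$-bialgebra $(H_{\rm LR}^{\epsilon},\backslash,|,\Delta_{\rm LR}^{\epsilon},\vee)$ of planar binary trees is the free unitary infinitesimal $(\backslash,\vee)$-bialgebra on the empty set; that is, for every unitary infinitesimal $(\backslash,\vee)$-bialgebra $(H,\backslash_H,1_H,\Delta_H,\vee_H)$ there exists a unique morphism of unitary infinitesimal $(\backslash,\vee)$-bialgebras $H_{\rm LR}^{\epsilon}\to H$.
   Context: All modules, algebras, tensor products and linear maps are over $\mathbf{k}$. Planar binary trees: a planar binary tree is a finite rooted planar tree in which every internal vertex has exactly two ordered incoming branches (left and right). The trivial tree, with no internal vertices, is denoted $|$. Let $\mathcal{Y}$ be the set of planar binary trees and $H_{\rm LR}^{\epsilon}:=\mathbf{k}\mathcal{Y}$ the free $\mathbf{k}$-module on it. Grafting: for $T_l,T_r\in\mathcal{Y}$, $T_l\vee T_r$ is the tree obtained by creating a new root with left branch $T_l$ and right branch $T_r$; $\vee$ is extended bilinearly. Every $T\in\mathcal{Y}$ with $T\neq |$ is uniquely of the form $T=T_l\vee T_r$. Under product: the bilinear map $\backslash$ on $H_{\rm LR}^{\epsilon}$ where, for trees $S,T$, $S\backslash T$ is obtained by adjoining the root of $T$ to the rightmost branch of $S$; recursively, $|\backslash T=T$ and $(S_l\vee S_r)\backslash T=S_l\vee(S_r\backslash T)$. The unit is $|$. Infinitesimal coproduct: the linear map $\Delta_{\rm LR}^{\epsilon}:H_{\rm LR}^{\epsilon}\to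 H_{\rm LR}^{\epsilon}\otimes H_{\rm LR}^{\epsilon}$ defined on trees recursively by $\Delta_{\rm LR}^{\epsilon}(|)=0$ and $$\Delta_{\rm LR}^{\epsilon}(T_l\vee T_r)=T_l\otimes T_r+(\mathrm{id}\otimes\vee)(\Delta_{\rm LR}^{\epsilon}(T_l)\otimes T_r)+(\vee\otimes\mathrm{id})(T_l\otimes\Delta_{\rm LR}^{\epsilon}(T_r)).$$ A unitary infinitesimal bialgebra (of weight zero) is a quadruple $(A,\cdot,1_A,\Delta)$ where $(A,\cdot,1_A)$ is a unitary associative algebra and $\Delta:A\to A\otimes A$ is a coassociative linear map (a counit is not required) such that $\Delta(ab)=a\cdot\Delta(b)+\Delta(a)\cdot b$ for all $a,b\in A$, where $a\cdot(u\otimes v)=(au)\otimes v$ and $(u\otimes v)\cdot b=u\otimes(vb)$. A unitary $(\backslash,\vee)$-algebra is a unitary associative algebra $(H,\backslash_H,1_H)$ together with a bilinear map $\vee_H:H\otimes H\to H$ such that $(x\vee_H y)\backslash_H z=x\vee_H(y\backslash_H z)$ for all $x,y,z\in H$. A unitary infinitesimal $(\backslash,\vee)$-bialgebra is a quintuple $(H,\backslash_H,1_H,\Delta_H,\vee_H)$ such that (a) $(H,\backslash_H,1_H,\vee_H)$ is a unitary $(\backslash,\vee)$-algebra; (b) $(H,\backslash_H,1_H,\Delta_H)$ is a unitary infinitesimal bialgebra; (c) for all $x,y\in H$, $$\Delta_H(x\vee_H y)=x\otimes y+(\mathrm{id}\otimes\vee_H)(\Delta_H(x)\otimes y)+(\vee_H\otimes\mathrm{id})(x\otimes\Delta_H(y)).$$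 A morphism of unitary infinitesimal $(\backslash,\vee)$-bialgebras is a linear map $\Phi$ preserving the product $\backslash$, the unit, the operation $\vee$, and the coproduct (i.e. $(\Phi\otimes\Phi)\Delta=\Delta'\Phi$, where $\Delta$ and $\Delta'$ are the coproducts of source and target). *)

theory Defs
  imports "HOL-Algebra.AbelCoset" "HOL-Algebra.Module"
begin

section \<open>Linear algebra over a commutative ring\<close>

definition module_hom ::
  "('r, 'm) ring_scheme \<Rightarrow> ('r, 'a, 'n) module_scheme \<Rightarrow> ('r, 'b, 'p) module_scheme \<Rightarrow> ('a \<Rightarrow> 'b) set"
  where "module_hom R M N =
    {f. f \<in> carrier M \<rightarrow> carrier N \<and>
        (\<forall>x\<in>carrier M. \<forall>y\<in>carrier M. f (x \<oplus>\<^bsub>M\<^esub> y) = f x \<oplus>\<^bsub>N\<^esub> f y) \<and>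
        (\<forall>r\<in>carrier R. \<forall>x\<in>carrier M. f (r \<odot>\<^bsub>M\<^esub> x) = r \<odot>\<^bsub>N\<^esub> f x)}"

text \<open>Linear maps out of a tensor product of two modules are given by (curried) bilinear maps.\<close>

definition bilinear_maps ::
  "('r, 'm) ring_scheme \<Rightarrow> ('r, 'a, 'n) module_scheme \<Rightarrow> ('r, 'b, 'p) module_scheme \<Rightarrow>
   ('r, 'c, 'q) module_scheme \<Rightarrow> ('a \<Rightarrow> 'b \<Rightarrow> 'c) set"
  where "bilinear_maps R M N P =
    {f. (\<forall>x\<in>carrier M. (\<lambda>y. f x y) \<in> module_hom R N P) \<and>
        (\<forall>y\<in>carrier N. (\<lambda>x. f x y) \<in> module_hom R M P)}"

text \<open>Elements of the free module on \<open>X\<close> are the finitely supported coefficient functions.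
  The ring fields \<open>mult\<close> and \<open>one\<close> of a module record are irrelevant for the module structure.\<close>

definition free_module :: "('r, 'm) ring_scheme \<Rightarrow> 'x set \<Rightarrow> ('r, 'x \<Rightarrow> 'r) module"
  where "free_module R X =
    \<lparr> carrier = {c. c \<in> X \<rightarrow> carrier R \<and> (\<forall>x. x \<notin> X \<longrightarrow> c x = \<zero>\<^bsub>R\<^esub>) \<and> finite {x. c x \<noteq> \<zero>\<^bsub>R\<^esub>}},
      mult = undefined, one = undefined,
      zero = (\<lambda>x. \<zero>\<^bsub>R\<^esub>),
      add = (\<lambda>c d x. c x \<oplus>\<^bsub>R\<^esub> d x),
      smult = (\<lambda>r c x. r \<otimes>\<^bsub>R\<^esub> c x) \<rparr>"

definition free_gen :: "('r, 'm) ring_scheme \<Rightarrow> 'x \<Rightarrow> 'x \<Rightarrow> 'r"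
  where "free_gen R x = (\<lambda>y. if y = x then \<one>\<^bsub>R\<^esub> else \<zero>\<^bsub>R\<^esub>)"

text \<open>The linear extension to the free module of a map \<open>f\<close> on generators.\<close>

definition lin_ext ::
  "('r, 'm) ring_scheme \<Rightarrow> ('r, 'a, 'n) module_scheme \<Rightarrow> ('x \<Rightarrow> 'a) \<Rightarrow> ('x \<Rightarrow> 'r) \<Rightarrow> 'a"
  where "lin_ext R P f c = (\<Oplus>\<^bsub>P\<^esub>x\<in>{x. c x \<noteq> \<zero>\<^bsub>R\<^esub>}. c x \<odot>\<^bsub>P\<^esub> f x)"

definition module_span ::
  "('r, 'm) ring_scheme \<Rightarrow> ('r, 'a, 'n) module_scheme \<Rightarrow> 'a set \<Rightarrow> 'a set"
  where "module_span R M A = \<Inter>{N. submodule N R M \<and> A \<subseteq> N}"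

definition quotient_module ::
  "('r, 'a, 'n) module_scheme \<Rightarrow> 'a set \<Rightarrow> ('r, 'a set) module"
  where "quotient_module M N =
    \<lparr> carrier = a_rcosets\<^bsub>M\<^esub> N,
      mult = undefined, one = undefined,
      zero = N,
      add = set_add M,
      smult = (\<lambda>r A. \<Union>a\<in>A. N +>\<^bsub>M\<^esub> (r \<odot>\<^bsub>M\<^esub> a)) \<rparr>"


section \<open>Tensor products\<close>

definition tensor_relators ::
  "('r, 'm) ring_scheme \<Rightarrow> ('r, 'a, 'n) module_scheme \<Rightarrow> ('r, 'b, 'p) module_scheme \<Rightarrow>
   ('a \<times> 'b \<Rightarrow> 'r) set"
  where "tensor_relators R M N =
   (let F = free_module R (carrier M \<times> carrier N); g = (\<lambda>x y. free_gen R (x, y)) in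
      {g (x \<oplus>\<^bsub>M\<^esub> x') y \<ominus>\<^bsub>F\<^esub> (g x y \<oplus>\<^bsub>F\<^esub> g x' y) | x x' y.
          x \<in> carrier M \<and> x' \<in> carrier M \<and> y \<in> carrier N} \<union>
      {g x (y \<oplus>\<^bsub>N\<^esub> y') \<ominus>\<^bsub>F\<^esub> (g x y \<oplus>\<^bsub>F\<^esub> g x y') | x y y'.
          x \<in> carrier M \<and> y \<in> carrier N \<and> y' \<in> carrier N} \<union>
      {g (r \<odot>\<^bsub>M\<^esub> x) y \<ominus>\<^bsub>F\<^esub> r \<odot>\<^bsub>F\<^esub> g x y | r x y.
          r \<in> carrier R \<and> x \<in> carrier M \<and> y \<in> carrier N} \<union>
      {g x (r \<odot>\<^bsub>N\<^esub> y) \<ominus>\<^bsub>F\<^esub> r \<odot>\<^bsub>F\<^esub> g x y | r x y.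
          r \<in> carrier R \<and> x \<in> carrier M \<and> y \<in> carrier N})"

definition tensor_null ::
  "('r, 'm) ring_scheme \<Rightarrow> ('r, 'a, 'n) module_scheme \<Rightarrow> ('r, 'b, 'p) module_scheme \<Rightarrow>
   ('a \<times> 'b \<Rightarrow> 'r) set"
  where "tensor_null R M N =
    module_span R (free_module R (carrier M \<times> carrier N)) (tensor_relators R M N)"

definition tensor ::
  "('r, 'm) ring_scheme \<Rightarrow> ('r, 'a, 'n) module_scheme \<Rightarrow> ('r, 'b, 'p) module_scheme \<Rightarrow>
   ('r, ('a \<times> 'b \<Rightarrow> 'r) set) module"
  where "tensor R M N =
    quotient_module (free_module R (carrier M \<times> carrier N)) (tensor_null R M N)"

definition pure_tensor ::
  "('r, 'm) ring_scheme \<Rightarrow> ('r, 'a, 'n) module_scheme \<Rightarrow> ('r, 'b, 'p) module_scheme \<Rightarrow>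
   'a \<Rightarrow> 'b \<Rightarrow> ('a \<times> 'b \<Rightarrow> 'r) set"
  where "pure_tensor R M N x y =
    tensor_null R M N +>\<^bsub>free_module R (carrier M \<times> carrier N)\<^esub> free_gen R (x, y)"

text \<open>The linear map \<open>M \<otimes> N \<rightarrow> P\<close> induced by a bilinear map \<open>f\<close>, i.e. \<open>x \<otimes> y \<mapsto> f x y\<close>:
  all representatives \<open>c\<close> of the tensor \<open>u\<close> yield the same value in \<open>P\<close>.\<close>

definition tensor_lift ::
  "('r, 'm) ring_scheme \<Rightarrow> ('r, 'c, 'q) module_scheme \<Rightarrow>
   ('a \<Rightarrow> 'b \<Rightarrow> 'c) \<Rightarrow> ('a \<times> 'b \<Rightarrow> 'r) set \<Rightarrow> 'c"
  where "tensor_lift R P f u = the_elem ((\<lambda>c. lin_ext R P (\<lambda>(x, y). f x y) c) ` u)"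

text \<open>\<open>tensor_map R M' N' f g\<close> is \<open>f \<otimes> g : M \<otimes> N \<rightarrow> M' \<otimes> N'\<close>.\<close>

definition tensor_map ::
  "('r, 'm) ring_scheme \<Rightarrow> ('r, 'c, 'n) module_scheme \<Rightarrow> ('r, 'd, 'p) module_scheme \<Rightarrow>
   ('a \<Rightarrow> 'c) \<Rightarrow> ('b \<Rightarrow> 'd) \<Rightarrow> ('a \<times> 'b \<Rightarrow> 'r) set \<Rightarrow> ('c \<times> 'd \<Rightarrow> 'r) set"
  where "tensor_map R M' N' f g =
    tensor_lift R (tensor R M' N') (\<lambda>x y. pure_tensor R M' N' (f x) (g y))"

text \<open>The canonical isomorphism \<open>(M \<otimes> N) \<otimes> P \<rightarrow> M \<otimes> (N \<otimes> P)\<close> and its inverse.\<close>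

definition tensor_assoc ::
  "('r, 'm) ring_scheme \<Rightarrow> ('r, 'a, 'n) module_scheme \<Rightarrow> ('r, 'b, 'p) module_scheme \<Rightarrow>
   ('r, 'c, 'q) module_scheme \<Rightarrow>
   (('a \<times> 'b \<Rightarrow> 'r) set \<times> 'c \<Rightarrow> 'r) set \<Rightarrow> ('a \<times> ('b \<times> 'c \<Rightarrow> 'r) set \<Rightarrow> 'r) set"
  where "tensor_assoc R M N P =
    (let T = tensor R M (tensor R N P) in
     tensor_lift R T (\<lambda>u z. tensor_lift R T
       (\<lambda>x y. pure_tensor R M (tensor R N P) x (pure_tensor R N P y z)) u))"

definition tensor_assoc_inv ::
  "('r, 'm) ring_scheme \<Rightarrow> ('r, 'a, 'n) module_scheme \<Rightarrow> ('r, 'b, 'p) module_scheme \<Rightarrow>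
   ('r, 'c, 'q) module_scheme \<Rightarrow>
   ('a \<times> ('b \<times> 'c \<Rightarrow> 'r) set \<Rightarrow> 'r) set \<Rightarrow> (('a \<times> 'b \<Rightarrow> 'r) set \<times> 'c \<Rightarrow> 'r) set"
  where "tensor_assoc_inv R M N P =
    (let T = tensor R (tensor R M N) P in
     tensor_lift R T (\<lambda>x. tensor_lift R T
       (\<lambda>y z. pure_tensor R (tensor R M N) P (pure_tensor R M N x y) z)))"


section \<open>Unitary infinitesimal bialgebras with a grafting operation\<close>

text \<open>The product and the unit of the algebra \<open>A\<close> are the ring fields of the module record.
  The library locale \<open>algebra\<close> is not applicable since it requires a commutative product.\<close>

locale unitary_algebra = module R A + ring A for R (structure) and A (structure) +
  assumes smult_mult_left:
    "\<lbrakk>r \<in> carrier R; x \<in> carrier A; y \<in> carrier A\<rbrakk> \<Longrightarrow>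
      (r \<odot>\<^bsub>A\<^esub> x) \<otimes>\<^bsub>A\<^esub> y = r \<odot>\<^bsub>A\<^esub> (x \<otimes>\<^bsub>A\<^esub> y)"
  and smult_mult_right:
    "\<lbrakk>r \<in> carrier R; x \<in> carrier A; y \<in> carrier A\<rbrakk> \<Longrightarrow>
      x \<otimes>\<^bsub>A\<^esub> (r \<odot>\<^bsub>A\<^esub> y) = r \<odot>\<^bsub>A\<^esub> (x \<otimes>\<^bsub>A\<^esub> y)"

locale unitary_infinitesimal_bialgebra = unitary_algebra R A
  for R (structure) and A (structure) +
  fixes \<Delta>
  assumes coproduct_linear: "\<Delta> \<in> module_hom R A (tensor R A A)"
  and coassociative:
    "x \<in> carrier A \<Longrightarrow>
      tensor_assoc R A A A (tensor_map R (tensor R A A) A \<Delta> id (\<Delta> x)) =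
      tensor_map R A (tensor R A A) id \<Delta> (\<Delta> x)"
  and coproduct_mult:
    "\<lbrakk>a \<in> carrier A; b \<in> carrier A\<rbrakk> \<Longrightarrow>
      \<Delta> (a \<otimes>\<^bsub>A\<^esub> b) =
        tensor_map R A A (\<lambda>u. a \<otimes>\<^bsub>A\<^esub> u) id (\<Delta> b)
        \<oplus>\<^bsub>tensor R A A\<^esub> tensor_map R A A id (\<lambda>v. v \<otimes>\<^bsub>A\<^esub> b) (\<Delta> a)"

locale unitary_under_vee_algebra = unitary_algebra R H
  for R (structure) and H (structure) +
  fixes vee
  assumes vee_bilinear: "vee \<in> bilinear_maps R H H H"
  and vee_mult:
    "\<lbrakk>x \<in> carrier H; y \<in> carrier H; z \<in> carrier H\<rbrakk> \<Longrightarrow>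
      vee x y \<otimes>\<^bsub>H\<^esub> z = vee x (y \<otimes>\<^bsub>H\<^esub> z)"

text \<open>\<open>vee_coproduct R H vee x y dx dy\<close> is
  \<open>x \<otimes> y + (id \<otimes> vee) (dx \<otimes> y) + (vee \<otimes> id) (x \<otimes> dy)\<close> for \<open>dx, dy \<in> H \<otimes> H\<close>.\<close>

definition vee_coproduct ::
  "('r, 'm) ring_scheme \<Rightarrow> ('r, 'a, 'n) module_scheme \<Rightarrow> ('a \<Rightarrow> 'a \<Rightarrow> 'a) \<Rightarrow> 'a \<Rightarrow> 'a \<Rightarrow>
   ('a \<times> 'a \<Rightarrow> 'r) set \<Rightarrow> ('a \<times> 'a \<Rightarrow> 'r) set \<Rightarrow> ('a \<times> 'a \<Rightarrow> 'r) set"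
  where "vee_coproduct R H vee x y dx dy =
    pure_tensor R H H x y
    \<oplus>\<^bsub>tensor R H H\<^esub> tensor_map R H H id (tensor_lift R H vee)
        (tensor_assoc R H H H (pure_tensor R (tensor R H H) H dx y))
    \<oplus>\<^bsub>tensor R H H\<^esub> tensor_map R H H (tensor_lift R H vee) id
        (tensor_assoc_inv R H H H (pure_tensor R H (tensor R H H) x dy))"

locale unitary_infinitesimal_under_vee_bialgebra =
  unitary_infinitesimal_bialgebra R H \<Delta> + unitary_under_vee_algebra R H vee
  for R (structure) and H (structure) and \<Delta> and vee +
  assumes coproduct_vee:
    "\<lbrakk>x \<in> carrier H; y \<in> carrier H\<rbrakk> \<Longrightarrow>
      \<Delta> (vee x y) = vee_coproduct R H vee x y (\<Delta> x) (\<Delta> y)"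

definition under_vee_bialgebra_hom ::
  "('r, 'm) ring_scheme \<Rightarrow>
   ('r, 'a, 'n) module_scheme \<Rightarrow> ('a \<Rightarrow> ('a \<times> 'a \<Rightarrow> 'r) set) \<Rightarrow> ('a \<Rightarrow> 'a \<Rightarrow> 'a) \<Rightarrow>
   ('r, 'b, 'p) module_scheme \<Rightarrow> ('b \<Rightarrow> ('b \<times> 'b \<Rightarrow> 'r) set) \<Rightarrow> ('b \<Rightarrow> 'b \<Rightarrow> 'b) \<Rightarrow>
   ('a \<Rightarrow> 'b) set"
  where "under_vee_bialgebra_hom R H \<Delta> vee H' \<Delta>' vee' =
    {\<Phi>. \<Phi> \<in> module_hom R H H' \<and>
        (\<forall>x\<in>carrier H. \<forall>y\<in>carrier H. \<Phi> (x \<otimes>\<^bsub>H\<^esub> y) = \<Phi> x \<otimes>\<^bsub>H'\<^esub> \<Phi> y) \<and>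
        \<Phi> \<one>\<^bsub>H\<^esub> = \<one>\<^bsub>H'\<^esub> \<and>
        (\<forall>x\<in>carrier H. \<forall>y\<in>carrier H. \<Phi> (vee x y) = vee' (\<Phi> x) (\<Phi> y)) \<and>
        (\<forall>x\<in>carrier H. tensor_map R H' H' \<Phi> \<Phi> (\<Delta> x) = \<Delta>' (\<Phi> x))}"


section \<open>The bialgebra of planar binary trees\<close>

datatype pbtree = Triv | Graft pbtree pbtree

text \<open>\<open>under S T\<close> glues the root of \<open>T\<close> to the rightmost leaf of \<open>S\<close>.\<close>

primrec under :: "pbtree \<Rightarrow> pbtree \<Rightarrow> pbtree"
  where
    "under Triv T = T"
  | "under (Graft Sl Sr) T = Graft Sl (under Sr T)"

definition bilin_ext ::
  "('r, 'm) ring_scheme \<Rightarrow> (pbtree \<Rightarrow> pbtree \<Rightarrow> pbtree) \<Rightarrow>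
   (pbtree \<Rightarrow> 'r) \<Rightarrow> (pbtree \<Rightarrow> 'r) \<Rightarrow> pbtree \<Rightarrow> 'r"
  where "bilin_ext R f a b =
    (let F = free_module R UNIV in
     lin_ext R F (\<lambda>S. lin_ext R F (\<lambda>T. free_gen R (f S T)) b) a)"

definition HLR :: "('r, 'm) ring_scheme \<Rightarrow> ('r, pbtree \<Rightarrow> 'r) module"
  where "HLR R =
    (free_module R UNIV)\<lparr> mult := bilin_ext R under, one := free_gen R Triv \<rparr>"

definition HLR_vee ::
  "('r, 'm) ring_scheme \<Rightarrow> (pbtree \<Rightarrow> 'r) \<Rightarrow> (pbtree \<Rightarrow> 'r) \<Rightarrow> pbtree \<Rightarrow> 'r"
  where "HLR_vee R = bilin_ext R Graft"

primrec tree_coproduct ::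
  "('r, 'm) ring_scheme \<Rightarrow> pbtree \<Rightarrow> ((pbtree \<Rightarrow> 'r) \<times> (pbtree \<Rightarrow> 'r) \<Rightarrow> 'r) set"
  where
    "tree_coproduct R Triv = \<zero>\<^bsub>tensor R (HLR R) (HLR R)\<^esub>"
  | "tree_coproduct R (Graft Tl Tr) =
       vee_coproduct R (HLR R) (HLR_vee R) (free_gen R Tl) (free_gen R Tr)
         (tree_coproduct R Tl) (tree_coproduct R Tr)"

definition HLR_coproduct ::
  "('r, 'm) ring_scheme \<Rightarrow> (pbtree \<Rightarrow> 'r) \<Rightarrow> ((pbtree \<Rightarrow> 'r) \<times> (pbtree \<Rightarrow> 'r) \<Rightarrow> 'r) set"
  where "HLR_coproduct R = lin_ext R (tensor R (HLR R) (HLR R)) (tree_coproduct R)"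

end

theory Submission
  imports Defs
begin

text \<open>
  The module of trees is generated by the trivial tree under grafting \<open>\<or>\<close> and linear combinations, and
  its structure is determined by grafting: the product satisfies \<open>(x \<or> y) \ z = x \<or> (y \ z)\<close>, and the
  coproduct satisfies \<open>\<Delta> (x \<or> y) = x \<otimes> y + \<Delta> x \<cdot> y + x \<cdot> \<Delta> y\<close>, where \<open>\<cdot> y\<close> grafts \<open>y\<close> to the right of
  the second tensor factor and \<open>x \<cdot>\<close> grafts \<open>x\<close> to the left of the first one. Both recursions are
  bilinear, so they hold for all elements once they hold for trees. Associativity, the Leibniz rule and
  coassociativity then follow by induction along \<open>\<or>\<close> (lemma \<open>HLR_induct\<close>).

  For the Leibniz rule and for coassociativity the induction step is an identity that holds in any
  algebra with a coproduct of this form, not only for trees (lemmas \<open>leibniz_graft\<close> and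
  \<open>coassociative_graft\<close>). In the second case the two iterated coproducts of \<open>x \<or> y\<close> expand into the
  same five terms, up to the iterated coproducts of \<open>x\<close> and of \<open>y\<close>. The identities live in two- and
  threefold tensor products; since all maps involved are linear, each of them is checked on pure
  tensors only.

  For the universal property, a morphism has to send the trivial tree to the unit and \<open>\<or>\<close> to \<open>vee\<close>,
  which determines it. Conversely, the linear extension of the evaluation of trees in \<open>H\<close> has these two
  properties, and they imply compatibility with the product and with the coproduct (lemma
  \<open>under_vee_bialgebra_homI\<close>). The induction for the coproduct starts from \<open>\<Delta> 1 = 0\<close>, which the Leibniz
  rule enforces in every infinitesimal bialgebra.
\<close>

section \<open>Linear maps and free modules\<close>

lemma module_homI:
  assumes "\<And>x. x \<in> carrier M \<Longrightarrow> f x \<in> carrier N"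
    and "\<And>x y. x \<in> carrier M \<Longrightarrow> y \<in> carrier M \<Longrightarrow> f (x \<oplus>\<^bsub>M\<^esub> y) = f x \<oplus>\<^bsub>N\<^esub> f y"
    and "\<And>r x. r \<in> carrier R \<Longrightarrow> x \<in> carrier M \<Longrightarrow> f (r \<odot>\<^bsub>M\<^esub> x) = r \<odot>\<^bsub>N\<^esub> f x"
  shows "f \<in> module_hom R M N"
  using assms by (auto simp: module_hom_def)

lemma module_hom_closed: "f \<in> module_hom R M N \<Longrightarrow> x \<in> carrier M \<Longrightarrow> f x \<in> carrier N"
  and module_hom_add: "f \<in> module_hom R M N \<Longrightarrow> x \<in> carrier M \<Longrightarrow> y \<in> carrier M \<Longrightarrow>
    f (x \<oplus>\<^bsub>M\<^esub> y) = f x \<oplus>\<^bsub>N\<^esub> f y"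
  and module_hom_smult: "f \<in> module_hom R M N \<Longrightarrow> r \<in> carrier R \<Longrightarrow> x \<in> carrier M \<Longrightarrow>
    f (r \<odot>\<^bsub>M\<^esub> x) = r \<odot>\<^bsub>N\<^esub> f x"
  by (auto simp: module_hom_def)

lemma module_hom_zero:
  assumes "module R M" "module R N" "f \<in> module_hom R M N"
  shows "f \<zero>\<^bsub>M\<^esub> = \<zero>\<^bsub>N\<^esub>"
proof -
  interpret M: module R M by fact
  interpret N: module R N by fact
  have "f (\<zero>\<^bsub>R\<^esub> \<odot>\<^bsub>M\<^esub> \<zero>\<^bsub>M\<^esub>) = \<zero>\<^bsub>R\<^esub> \<odot>\<^bsub>N\<^esub> f \<zero>\<^bsub>M\<^esub>"
    by (rule module_hom_smult[OF assms(3)]) auto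
  with module_hom_closed[OF assms(3), of "\<zero>\<^bsub>M\<^esub>"] show ?thesis by simp
qed

lemma module_hom_comp:
  "f \<in> module_hom R M N \<Longrightarrow> g \<in> module_hom R N P \<Longrightarrow> (\<lambda>x. g (f x)) \<in> module_hom R M P"
  by (rule module_homI) (simp_all add: module_hom_closed module_hom_add module_hom_smult)

lemma module_hom_id: "id \<in> module_hom R M M"
  by (auto simp: module_hom_def)

lemma free_module_carrier:
  "c \<in> carrier (free_module R X) \<longleftrightarrow>
    c \<in> X \<rightarrow> carrier R \<and> (\<forall>x. x \<notin> X \<longrightarrow> c x = \<zero>\<^bsub>R\<^esub>) \<and> finite {x. c x \<noteq> \<zero>\<^bsub>R\<^esub>}"
  by (simp add: free_module_def)

lemma free_module_sel [simp]:
  "\<zero>\<^bsub>free_module R X\<^esub> = (\<lambda>x. \<zero>\<^bsub>R\<^esub>)"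
  "c \<oplus>\<^bsub>free_module R X\<^esub> d = (\<lambda>x. c x \<oplus>\<^bsub>R\<^esub> d x)"
  "r \<odot>\<^bsub>free_module R X\<^esub> c = (\<lambda>x. r \<otimes>\<^bsub>R\<^esub> c x)"
  by (simp_all add: free_module_def)

lemma module_free_module:
  assumes "cring R"
  shows "module R (free_module R X)"
proof -
  interpret cring R by fact
  let ?F = "free_module R X"
  have val: "c x \<in> carrier R" if "c \<in> carrier ?F" for c x
    using that by (cases "x \<in> X") (auto simp: free_module_carrier)
  have add: "c \<oplus>\<^bsub>?F\<^esub> d \<in> carrier ?F" if "c \<in> carrier ?F" "d \<in> carrier ?F" for c d
  proof -
    have "{x. c x \<oplus>\<^bsub>R\<^esub> d x \<noteq> \<zero>\<^bsub>R\<^esub>} \<subseteq> {x. c x \<noteq> \<zero>\<^bsub>R\<^esub>} \<union> {x. d x \<noteq> \<zero>\<^bsub>R\<^esub>}"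
      by auto
    with that show ?thesis
      by (auto simp: free_module_carrier intro: finite_subset)
  qed
  have smult: "r \<odot>\<^bsub>?F\<^esub> c \<in> carrier ?F" if "r \<in> carrier R" "c \<in> carrier ?F" for r c
  proof -
    have "{x. r \<otimes>\<^bsub>R\<^esub> c x \<noteq> \<zero>\<^bsub>R\<^esub>} \<subseteq> {x. c x \<noteq> \<zero>\<^bsub>R\<^esub>}"
      using that by auto
    with that show ?thesis
      by (auto simp: free_module_carrier intro: finite_subset)
  qed
  have inv: "\<exists>d\<in>carrier ?F. d \<oplus>\<^bsub>?F\<^esub> c = \<zero>\<^bsub>?F\<^esub>" if "c \<in> carrier ?F" for c
    using smult[of "\<ominus>\<^bsub>R\<^esub> \<one>\<^bsub>R\<^esub>" c] that val[OF that]
    by (intro bexI[of _ "(\<ominus>\<^bsub>R\<^esub> \<one>\<^bsub>R\<^esub>) \<odot>\<^bsub>?F\<^esub> c"]) (auto simp: l_minus l_neg)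
  have zero: "\<zero>\<^bsub>?F\<^esub> \<in> carrier ?F"
    by (simp add: free_module_carrier)
  have "abelian_group ?F"
    by (rule abelian_groupI, fact add, fact zero) (use inv in \<open>auto simp: val a_ac\<close>)
  then show ?thesis
    by (intro moduleI assms smult)
       (auto simp: val l_distr r_distr m_assoc)
qed

lemma free_module_val:
  "cring R \<Longrightarrow> c \<in> carrier (free_module R X) \<Longrightarrow> c x \<in> carrier R"
  by (cases "x \<in> X") (auto simp: free_module_carrier cring_def ring.ring_simprules)

lemma free_gen_carrier:
  assumes "cring R" "x \<in> X"
  shows "free_gen R x \<in> carrier (free_module R X)"
proof -
  interpret cring R by fact
  show ?thesis
    using assms(2) by (auto simp: free_module_carrier free_gen_def)
qed

text \<open>Peeling off one point of the support at a time writes a finitely supported function as a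
  linear combination of generators.\<close>

lemma free_module_induct [consumes 2, case_names zero gen add smult]:
  assumes R: "cring R" and c: "c \<in> carrier (free_module R X)"
    and zero: "P \<zero>\<^bsub>free_module R X\<^esub>"
    and gen: "\<And>x. x \<in> X \<Longrightarrow> P (free_gen R x)"
    and add: "\<And>c d. c \<in> carrier (free_module R X) \<Longrightarrow> d \<in> carrier (free_module R X) \<Longrightarrow>
      P c \<Longrightarrow> P d \<Longrightarrow> P (c \<oplus>\<^bsub>free_module R X\<^esub> d)"
    and smult: "\<And>r c. r \<in> carrier R \<Longrightarrow> c \<in> carrier (free_module R X) \<Longrightarrow> P c \<Longrightarrow>
      P (r \<odot>\<^bsub>free_module R X\<^esub> c)"
  shows "P c"
proof -
  interpret cring R by fact
  interpret F: module R "free_module R X" by (rule module_free_module[OF R])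
  have "finite {x. c x \<noteq> \<zero>\<^bsub>R\<^esub>}" using c by (simp add: free_module_carrier)
  moreover have "P c" if "finite A" "{x. c x \<noteq> \<zero>\<^bsub>R\<^esub>} = A" "c \<in> carrier (free_module R X)" for A c
    using that
  proof (induction A arbitrary: c)
    case empty
    then have "c = \<zero>\<^bsub>free_module R X\<^esub>" by auto
    then show ?case using zero by simp
  next
    case (insert a A)
    let ?d = "c(a := \<zero>\<^bsub>R\<^esub>)"
    have supp: "{x. ?d x \<noteq> \<zero>\<^bsub>R\<^esub>} = A" using insert.prems(1) insert.hyps by auto
    have aX: "a \<in> X" using insert.prems by (auto simp: free_module_carrier)
    have d: "?d \<in> carrier (free_module R X)"
      using insert.prems(2) supp insert.hyps by (auto simp: free_module_carrier Pi_iff)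
    have ca: "c a \<in> carrier R" using insert.prems(2) R by (rule free_module_val[rotated])
    have g: "free_gen R a \<in> carrier (free_module R X)" by (rule free_gen_carrier[OF R aX])
    have "c = ?d \<oplus>\<^bsub>free_module R X\<^esub> (c a \<odot>\<^bsub>free_module R X\<^esub> free_gen R a)"
      using free_module_val[OF R insert.prems(2)] by (auto simp: free_gen_def fun_eq_iff)
    moreover have "P \<dots>"
      by (rule add[OF d _ insert.IH[OF supp d] smult[OF ca g gen[OF aX]]])
         (rule F.smult_closed[OF ca g])
    ultimately show ?case by metis
  qed
  ultimately show ?thesis using c by blast
qed

text \<open>Summing over any finite set that contains the support allows the values at \<open>c\<close>, \<open>d\<close> and \<open>c + d\<close>,
  whose supports differ, to be compared over one index set.\<close>

lemma lin_ext_superset: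
  assumes "module R P" "c \<in> carrier (free_module R X)" "f \<in> X \<rightarrow> carrier P"
    and "finite A" "{x. c x \<noteq> \<zero>\<^bsub>R\<^esub>} \<subseteq> A" "A \<subseteq> X"
  shows "lin_ext R P f c = (\<Oplus>\<^bsub>P\<^esub>x\<in>A. c x \<odot>\<^bsub>P\<^esub> f x)"
proof -
  interpret P: module R P by fact
  have "(\<Oplus>\<^bsub>P\<^esub>x\<in>{x. c x \<noteq> \<zero>\<^bsub>R\<^esub>}. c x \<odot>\<^bsub>P\<^esub> f x) = (\<Oplus>\<^bsub>P\<^esub>x\<in>A. c x \<odot>\<^bsub>P\<^esub> f x)"
    using assms by (intro P.M.add.finprod_mono_neutral_cong_left)
       (auto simp: free_module_carrier Pi_iff subset_iff)
  then show ?thesis by (simp add: lin_ext_def)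
qed

lemma lin_ext_hom:
  assumes "module R P" "f \<in> X \<rightarrow> carrier P"
  shows "lin_ext R P f \<in> module_hom R (free_module R X) P"
proof -
  interpret P: module R P by fact
  have R: "cring R" by unfold_locales
  interpret F: module R "free_module R X" by (rule module_free_module[OF R])
  note val = free_module_val[OF R]
  have supp: "finite {x. c x \<noteq> \<zero>\<^bsub>R\<^esub>}" "{x. c x \<noteq> \<zero>\<^bsub>R\<^esub>} \<subseteq> X"
    if "c \<in> carrier (free_module R X)" for c
    using that by (auto simp: free_module_carrier)
  have closed: "lin_ext R P f c \<in> carrier P" if "c \<in> carrier (free_module R X)" for c
    using supp[OF that] assms(2) val[OF that]
    unfolding lin_ext_def by (intro P.M.finsum_closed) auto
  show ?thesis
  proof (rule module_homI)
    fix c d assume c: "c \<in> carrier (free_module R X)" and d: "d \<in> carrier (free_module R X)"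
    let ?A = "{x. c x \<noteq> \<zero>\<^bsub>R\<^esub>} \<union> {x. d x \<noteq> \<zero>\<^bsub>R\<^esub>}"
    have A: "finite ?A" "?A \<subseteq> X" using supp[OF c] supp[OF d] by auto
    note ext = lin_ext_superset[OF assms(1) _ assms(2) A(1) _ A(2)]
    have fx: "x \<in> ?A \<Longrightarrow> f x \<in> carrier P" for x using A assms(2) by auto
    have "lin_ext R P f (c \<oplus>\<^bsub>free_module R X\<^esub> d)
        = (\<Oplus>\<^bsub>P\<^esub>x\<in>?A. (c \<oplus>\<^bsub>free_module R X\<^esub> d) x \<odot>\<^bsub>P\<^esub> f x)"
      by (rule ext) (use F.M.a_closed[OF c d] in auto)
    also have "\<dots> = (\<Oplus>\<^bsub>P\<^esub>x\<in>?A. c x \<odot>\<^bsub>P\<^esub> f x \<oplus>\<^bsub>P\<^esub> d x \<odot>\<^bsub>P\<^esub> f x)"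
      by (rule P.M.finsum_cong') (use fx val[OF c] val[OF d] in \<open>auto simp: P.smult_l_distr\<close>)
    also have "\<dots> = (\<Oplus>\<^bsub>P\<^esub>x\<in>?A. c x \<odot>\<^bsub>P\<^esub> f x) \<oplus>\<^bsub>P\<^esub> (\<Oplus>\<^bsub>P\<^esub>x\<in>?A. d x \<odot>\<^bsub>P\<^esub> f x)"
      by (rule P.M.finsum_addf) (use fx val[OF c] val[OF d] in auto)
    also have "\<dots> = lin_ext R P f c \<oplus>\<^bsub>P\<^esub> lin_ext R P f d"
      using ext[OF c] ext[OF d] by auto
    finally show "lin_ext R P f (c \<oplus>\<^bsub>free_module R X\<^esub> d) = lin_ext R P f c \<oplus>\<^bsub>P\<^esub> lin_ext R P f d" .
  next
    fix r c assume r: "r \<in> carrier R" and c: "c \<in> carrier (free_module R X)"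
    note ext = lin_ext_superset[OF assms(1) _ assms(2) supp(1)[OF c] _ supp(2)[OF c]]
    have fx: "c x \<noteq> \<zero>\<^bsub>R\<^esub> \<Longrightarrow> f x \<in> carrier P" for x using supp[OF c] assms(2) by auto
    have "lin_ext R P f (r \<odot>\<^bsub>free_module R X\<^esub> c)
        = (\<Oplus>\<^bsub>P\<^esub>x\<in>{x. c x \<noteq> \<zero>\<^bsub>R\<^esub>}. (r \<odot>\<^bsub>free_module R X\<^esub> c) x \<odot>\<^bsub>P\<^esub> f x)"
      by (rule ext) (use F.smult_closed[OF r c] r in auto)
    also have "\<dots> = (\<Oplus>\<^bsub>P\<^esub>x\<in>{x. c x \<noteq> \<zero>\<^bsub>R\<^esub>}. r \<odot>\<^bsub>P\<^esub> (c x \<odot>\<^bsub>P\<^esub> f x))"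
      by (rule P.M.finsum_cong') (use r fx val[OF c] in \<open>auto simp: P.smult_assoc1\<close>)
    also have "\<dots> = r \<odot>\<^bsub>P\<^esub> lin_ext R P f c"
      unfolding lin_ext_def
      by (rule P.finsum_smult_ldistr[symmetric]) (use r supp[OF c] fx val[OF c] in auto)
    finally show "lin_ext R P f (r \<odot>\<^bsub>free_module R X\<^esub> c) = r \<odot>\<^bsub>P\<^esub> lin_ext R P f c" .
  qed (rule closed)
qed

text \<open>Summing over the singleton \<open>{x}\<close> instead of the support also covers the zero ring, in which the
  support of a generator is empty.\<close>

lemma lin_ext_gen:
  assumes "module R P" "f x \<in> carrier P"
  shows "lin_ext R P f (free_gen R x) = f x"
proof -
  interpret P: module R P by fact
  have R: "cring R" by unfold_locales
  have "lin_ext R P f (free_gen R x) = (\<Oplus>\<^bsub>P\<^esub>y\<in>{x}. free_gen R x y \<odot>\<^bsub>P\<^esub> f y)"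
    by (rule lin_ext_superset[where X = "{x}"])
       (use assms free_gen_carrier[OF R, of x "{x}"] in \<open>auto simp: free_gen_def\<close>)
  also have "\<dots> = f x"
    using assms by (simp add: free_gen_def)
  finally show ?thesis .
qed

section \<open>Quotient modules\<close>

lemma module_span_submodule:
  assumes "module R M" "B \<subseteq> carrier M"
  shows "submodule (module_span R M B) R M" "B \<subseteq> module_span R M B"
proof -
  interpret M: module R M by fact
  have car: "submodule (carrier M) R M" by (rule M.carrier_is_submodule)
  note E = M.submoduleE
  show "B \<subseteq> module_span R M B" by (auto simp: module_span_def)
  show "submodule (module_span R M B) R M"
  proof (rule M.submoduleI)
    show "module_span R M B \<subseteq> carrier M"
      using car assms(2) by (auto simp: module_span_def)
    have "\<zero>\<^bsub>M\<^esub> \<in> N" if "submodule N R M" for N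
      using subgroup.one_closed[OF submodule.axioms(1)[OF that]] by simp
    then show "\<zero>\<^bsub>M\<^esub> \<in> module_span R M B" by (auto simp: module_span_def)
  qed (auto simp: module_span_def intro: E)
qed

lemma module_span_least:
  "submodule N R M \<Longrightarrow> B \<subseteq> N \<Longrightarrow> module_span R M B \<subseteq> N"
  by (auto simp: module_span_def)

lemma submodule_abelian_subgroup:
  assumes "module R M" "submodule N R M"
  shows "abelian_subgroup N M"
proof -
  interpret M: module R M by fact
  show ?thesis
    by (rule abelian_subgroupI2[OF M.a_comm_group submodule.axioms(1)[OF assms(2)]])
qed

text \<open>The union that defines scalar multiplication runs over the representatives of a coset, and all
  of them yield the same coset because the submodule is closed under scalars.\<close>

lemma quotient_module_smult:
  assumes "module R M" "submodule N R M" "r \<in> carrier R" "x \<in> carrier M"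
  shows "r \<odot>\<^bsub>quotient_module M N\<^esub> (N +>\<^bsub>M\<^esub> x) = N +>\<^bsub>M\<^esub> (r \<odot>\<^bsub>M\<^esub> x)"
proof -
  interpret M: module R M by fact
  interpret N: submodule N R M by fact
  interpret Q: abelian_subgroup N M by (rule submodule_abelian_subgroup[OF assms(1,2)])
  have "N +>\<^bsub>M\<^esub> (r \<odot>\<^bsub>M\<^esub> a) = N +>\<^bsub>M\<^esub> (r \<odot>\<^bsub>M\<^esub> x)" if "a \<in> N +>\<^bsub>M\<^esub> x" for a
  proof -
    from that obtain n where n: "n \<in> N" and a: "a = n \<oplus>\<^bsub>M\<^esub> x"
      by (auto simp: a_r_coset_def')
    have nM: "n \<in> carrier M" using n Q.a_subset by blast
    have "r \<odot>\<^bsub>M\<^esub> a = r \<odot>\<^bsub>M\<^esub> n \<oplus>\<^bsub>M\<^esub> r \<odot>\<^bsub>M\<^esub> x"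
      using a nM assms(3,4) by (simp add: M.smult_r_distr)
    then have "r \<odot>\<^bsub>M\<^esub> a \<in> N +>\<^bsub>M\<^esub> (r \<odot>\<^bsub>M\<^esub> x)"
      using n assms(3) by (auto simp: a_r_coset_def')
    then show ?thesis
      by (rule M.a_repr_independence[OF _ M.smult_closed[OF assms(3,4)] Q.a_subgroup, symmetric])
  qed
  then have "(\<Union>a\<in>N +>\<^bsub>M\<^esub> x. N +>\<^bsub>M\<^esub> (r \<odot>\<^bsub>M\<^esub> a)) = N +>\<^bsub>M\<^esub> (r \<odot>\<^bsub>M\<^esub> x)"
    by (intro UN_constant_eq[OF Q.a_rcos_self[OF assms(4)]] ballI)
  then show ?thesis by (simp add: quotient_module_def)
qed

lemma quotient_module_add:
  assumes "module R M" "submodule N R M" "x \<in> carrier M" "y \<in> carrier M"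
  shows "(N +>\<^bsub>M\<^esub> x) \<oplus>\<^bsub>quotient_module M N\<^esub> (N +>\<^bsub>M\<^esub> y) = N +>\<^bsub>M\<^esub> (x \<oplus>\<^bsub>M\<^esub> y)"
proof -
  interpret Q: abelian_subgroup N M by (rule submodule_abelian_subgroup[OF assms(1,2)])
  show ?thesis using Q.a_rcos_sum[OF assms(3,4)] by (simp add: quotient_module_def)
qed

lemma quotient_module_carrier:
  "u \<in> carrier (quotient_module M N) \<longleftrightarrow> (\<exists>x\<in>carrier M. u = N +>\<^bsub>M\<^esub> x)"
  by (auto simp: quotient_module_def A_RCOSETS_def')

lemma module_quotient_module:
  assumes "module R M" "submodule N R M"
  shows "module R (quotient_module M N)"
proof -
  interpret M: module R M by fact
  interpret Q: abelian_subgroup N M by (rule submodule_abelian_subgroup[OF assms])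
  note smult = quotient_module_smult[OF assms] and add = quotient_module_add[OF assms]
  have closed: "N +>\<^bsub>M\<^esub> x \<in> carrier (quotient_module M N)" if "x \<in> carrier M" for x
    using that by (auto simp: quotient_module_carrier)
  have elim: thesis if "u \<in> carrier (quotient_module M N)"
    "\<And>x. x \<in> carrier M \<Longrightarrow> u = N +>\<^bsub>M\<^esub> x \<Longrightarrow> thesis" for u thesis
    using that by (auto simp: quotient_module_carrier)
  have zero: "\<zero>\<^bsub>quotient_module M N\<^esub> = N +>\<^bsub>M\<^esub> \<zero>\<^bsub>M\<^esub>"
    using Q.a_subset by (simp add: quotient_module_def)
  have inv: "\<exists>v\<in>carrier (quotient_module M N).
      v \<oplus>\<^bsub>quotient_module M N\<^esub> (N +>\<^bsub>M\<^esub> x) = N +>\<^bsub>M\<^esub> \<zero>\<^bsub>M\<^esub>" if "x \<in> carrier M" for x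
    using that by (intro bexI[of _ "N +>\<^bsub>M\<^esub> (\<ominus>\<^bsub>M\<^esub> x)"])
      (auto simp: M.M.l_neg add closed)
  have ab: "abelian_group (quotient_module M N)"
    by (rule abelian_groupI; ((erule elim)+)?)
       (simp_all add: closed inv add zero M.M.a_ac del: M.a_coset_add_zero)
  show ?thesis
    by (rule moduleI[OF M.R.is_cring ab]; (erule elim)+)
       (simp_all add: closed smult add M.smult_l_distr M.smult_r_distr M.smult_assoc1)
qed

section \<open>Tensor products and their universal property\<close>

lemma bilinear_mapsI:
  assumes "\<And>x. x \<in> carrier M \<Longrightarrow> (\<lambda>y. f x y) \<in> module_hom R N P"
    and "\<And>y. y \<in> carrier N \<Longrightarrow> (\<lambda>x. f x y) \<in> module_hom R M P"
  shows "f \<in> bilinear_maps R M N P"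
  using assms by (auto simp: bilinear_maps_def)

lemma bilinear_mapsD:
  assumes "f \<in> bilinear_maps R M N P"
  shows "x \<in> carrier M \<Longrightarrow> (\<lambda>y. f x y) \<in> module_hom R N P"
    and "y \<in> carrier N \<Longrightarrow> (\<lambda>x. f x y) \<in> module_hom R M P"
    and "x \<in> carrier M \<Longrightarrow> y \<in> carrier N \<Longrightarrow> f x y \<in> carrier P"
  using assms by (auto simp: bilinear_maps_def module_hom_def)

lemma tensor_relators_subset:
  assumes "module R M" "module R N"
  shows "tensor_relators R M N \<subseteq> carrier (free_module R (carrier M \<times> carrier N))"
proof -
  interpret M: module R M by fact
  interpret N: module R N by fact
  have R: "cring R" by unfold_locales
  interpret F: module R "free_module R (carrier M \<times> carrier N)" by (rule module_free_module[OF R])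
  have g: "free_gen R (x, y) \<in> carrier (free_module R (carrier M \<times> carrier N))"
    if "x \<in> carrier M" "y \<in> carrier N" for x y
    using that by (intro free_gen_carrier[OF R]) auto
  show ?thesis
    unfolding tensor_relators_def Let_def
    by (auto simp del: free_module_sel intro!: F.M.minus_closed F.M.a_closed F.smult_closed g)
qed

lemma tensor_null_submodule:
  assumes "module R M" "module R N"
  shows "submodule (tensor_null R M N) R (free_module R (carrier M \<times> carrier N))"
    and "tensor_relators R M N \<subseteq> tensor_null R M N"
proof -
  interpret M: module R M by fact
  have "module R (free_module R (carrier M \<times> carrier N))"
    by (rule module_free_module[OF M.R.is_cring])
  from module_span_submodule[OF this tensor_relators_subset[OF assms]]
  show "submodule (tensor_null R M N) R (free_module R (carrier M \<times> carrier N))"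
    and "tensor_relators R M N \<subseteq> tensor_null R M N"
    by (simp_all add: tensor_null_def)
qed

lemma module_tensor:
  assumes "module R M" "module R N"
  shows "module R (tensor R M N)"
proof -
  interpret M: module R M by fact
  show ?thesis
    unfolding tensor_def
    by (rule module_quotient_module[OF module_free_module[OF M.R.is_cring] tensor_null_submodule(1)[OF assms]])
qed

lemma coset_eq_if_diff:
  assumes "module R F" "submodule K R F" "a \<in> carrier F" "b \<in> carrier F" "a \<ominus>\<^bsub>F\<^esub> b \<in> K"
  shows "K +>\<^bsub>F\<^esub> a = K +>\<^bsub>F\<^esub> b"
proof -
  interpret F: module R F by fact
  interpret K: abelian_subgroup K F by (rule submodule_abelian_subgroup[OF assms(1,2)])
  have "a \<in> K +>\<^bsub>F\<^esub> b"
    using assms by (subst K.a_rcos_module) (auto simp: a_minus_def)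
  then show ?thesis
    by (rule F.M.a_repr_independence[OF _ assms(4) K.a_subgroup, symmetric])
qed

text \<open>Each of the four laws identifies two cosets whose difference is a member of one of the four
  families of relators.\<close>

lemma pure_tensor_bilinear:
  assumes "module R M" "module R N"
  shows "pure_tensor R M N \<in> bilinear_maps R M N (tensor R M N)"
proof -
  interpret M: module R M by fact
  interpret N: module R N by fact
  have R: "cring R" by unfold_locales
  define F where "F = free_module R (carrier M \<times> carrier N)"
  have F: "module R F" unfolding F_def by (rule module_free_module[OF R])
  interpret F: module R F by fact
  define K where "K = tensor_null R M N"
  note sub = tensor_null_submodule[OF assms, folded F_def K_def]
  have g: "free_gen R (x, y) \<in> carrier F"
    if "x \<in> carrier M" "y \<in> carrier N" for x y
    using that unfolding F_def by (intro free_gen_carrier[OF R]) auto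
  note add = quotient_module_add[OF F sub(1)] and smult = quotient_module_smult[OF F sub(1)]
  have T: "tensor R M N = quotient_module F K" by (simp add: tensor_def F_def K_def)
  have p: "pure_tensor R M N x y = K +>\<^bsub>F\<^esub> free_gen R (x, y)" for x y
    by (simp add: pure_tensor_def F_def K_def)
  have rel: "tensor_relators R M N \<subseteq> K" by (rule sub(2))
  note rel' = rel[unfolded tensor_relators_def Let_def, folded F_def]
  have closed: "K +>\<^bsub>F\<^esub> c \<in> carrier (quotient_module F K)" if "c \<in> carrier F" for c
    using that by (auto simp: quotient_module_carrier)
  show ?thesis
    unfolding T
    by (rule bilinear_mapsI; rule module_homI)
       (unfold p, simp_all add: g closed add smult,
        (rule coset_eq_if_diff[OF F sub(1)], simp_all add: g, rule subsetD[OF rel'], blast)+)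
qed

lemma pure_tensor_closed:
  "module R M \<Longrightarrow> module R N \<Longrightarrow> x \<in> carrier M \<Longrightarrow> y \<in> carrier N \<Longrightarrow>
    pure_tensor R M N x y \<in> carrier (tensor R M N)"
  by (rule bilinear_mapsD(3)[OF pure_tensor_bilinear])

text \<open>Pure tensors generate the tensor product already as an additive monoid, so a property need not
  be checked on zero, on negatives or on scalar multiples.\<close>

lemma tensor_induct [consumes 3, case_names pure add]:
  assumes M: "module R M" and N: "module R N" and u: "u \<in> carrier (tensor R M N)"
    and pure: "\<And>x y. x \<in> carrier M \<Longrightarrow> y \<in> carrier N \<Longrightarrow> P (pure_tensor R M N x y)"
    and add: "\<And>u v. u \<in> carrier (tensor R M N) \<Longrightarrow> v \<in> carrier (tensor R M N) \<Longrightarrow>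
      P u \<Longrightarrow> P v \<Longrightarrow> P (u \<oplus>\<^bsub>tensor R M N\<^esub> v)"
  shows "P u"
proof -
  interpret M: module R M by fact
  interpret N: module R N by fact
  have R: "cring R" by unfold_locales
  define F where "F = free_module R (carrier M \<times> carrier N)"
  have F: "module R F" unfolding F_def by (rule module_free_module[OF R])
  interpret F: module R F by fact
  define K where "K = tensor_null R M N"
  note sub = tensor_null_submodule[OF M N, folded F_def K_def]
  interpret K: abelian_subgroup K F by (rule submodule_abelian_subgroup[OF F sub(1)])
  have T: "tensor R M N = quotient_module F K" by (simp add: tensor_def F_def K_def)
  have p: "pure_tensor R M N x y = K +>\<^bsub>F\<^esub> free_gen R (x, y)" for x y
    by (simp add: pure_tensor_def F_def K_def)
  interpret T: module R "tensor R M N" by (rule module_tensor[OF M N])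
  have closed: "K +>\<^bsub>F\<^esub> c \<in> carrier (tensor R M N)" if "c \<in> carrier F" for c
    using that by (auto simp: quotient_module_carrier T)
  have null: "\<zero>\<^bsub>tensor R M N\<^esub> = pure_tensor R M N \<zero>\<^bsub>M\<^esub> \<zero>\<^bsub>N\<^esub>"
    by (rule module_hom_zero[OF N module_tensor[OF M N], symmetric])
       (rule bilinear_mapsD(1)[OF pure_tensor_bilinear[OF M N]], simp)
  \<comment> \<open>Scalars are carried along, because a multiple of a generator is again a pure tensor.\<close>
  have "\<forall>r\<in>carrier R. P (r \<odot>\<^bsub>tensor R M N\<^esub> (K +>\<^bsub>F\<^esub> c))" if "c \<in> carrier F" for c
    using R that[unfolded F_def]
  proof (induction rule: free_module_induct)
    case zero
    have "K +>\<^bsub>F\<^esub> \<zero>\<^bsub>F\<^esub> = \<zero>\<^bsub>tensor R M N\<^esub>"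
      using K.a_subset by (simp add: T quotient_module_def del: free_module_sel)
    moreover have "P \<zero>\<^bsub>tensor R M N\<^esub>"
      unfolding null by (rule pure) auto
    ultimately show ?case by (fold F_def) (simp del: free_module_sel)
  next
    case (gen z)
    then obtain x y where z: "z = (x, y)" "x \<in> carrier M" "y \<in> carrier N" by auto
    show ?case
    proof
      fix r assume r: "r \<in> carrier R"
      have "r \<odot>\<^bsub>tensor R M N\<^esub> pure_tensor R M N x y = pure_tensor R M N (r \<odot>\<^bsub>M\<^esub> x) y"
        by (rule module_hom_smult[OF bilinear_mapsD(2)[OF pure_tensor_bilinear[OF M N] z(3)] r z(2), symmetric])
      then show "P (r \<odot>\<^bsub>tensor R M N\<^esub> (K +>\<^bsub>F\<^esub> free_gen R z))"
        using pure[OF M.smult_closed[OF r z(2)] z(3)] by (simp add: p z(1))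
    qed
  next
    case (add c d)
    then have cd: "c \<in> carrier F" "d \<in> carrier F" by (simp_all add: F_def)
    show ?case
    proof
      fix r assume r: "r \<in> carrier R"
      have "r \<odot>\<^bsub>tensor R M N\<^esub> (K +>\<^bsub>F\<^esub> (c \<oplus>\<^bsub>F\<^esub> d)) =
          r \<odot>\<^bsub>tensor R M N\<^esub> (K +>\<^bsub>F\<^esub> c) \<oplus>\<^bsub>tensor R M N\<^esub> r \<odot>\<^bsub>tensor R M N\<^esub> (K +>\<^bsub>F\<^esub> d)"
        using quotient_module_add[OF F sub(1) cd] T.smult_r_distr[OF r closed[OF cd(1)] closed[OF cd(2)]]
        by (simp add: T del: free_module_sel)
      then show "P (r \<odot>\<^bsub>tensor R M N\<^esub> (K +>\<^bsub>F\<^esub> (c \<oplus>\<^bsub>free_module R (carrier M \<times> carrier N)\<^esub> d)))"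
        using add r closed[OF cd(1)] closed[OF cd(2)] assms(5) by (fold F_def) simp
    qed
  next
    case (smult r c)
    then have c: "c \<in> carrier F" by (simp add: F_def)
    show ?case
    proof
      fix s assume s: "s \<in> carrier R"
      have "s \<odot>\<^bsub>tensor R M N\<^esub> (K +>\<^bsub>F\<^esub> (r \<odot>\<^bsub>F\<^esub> c)) = (s \<otimes>\<^bsub>R\<^esub> r) \<odot>\<^bsub>tensor R M N\<^esub> (K +>\<^bsub>F\<^esub> c)"
        using quotient_module_smult[OF F sub(1) smult(1) c] T.smult_assoc1[OF s smult(1) closed[OF c]]
        by (simp add: T del: free_module_sel)
      then show "P (s \<odot>\<^bsub>tensor R M N\<^esub> (K +>\<^bsub>F\<^esub> (r \<odot>\<^bsub>free_module R (carrier M \<times> carrier N)\<^esub> c)))"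
        using smult s by (fold F_def) simp
    qed
  qed
  moreover from u obtain c where "c \<in> carrier F" "u = K +>\<^bsub>F\<^esub> c"
    by (auto simp: T quotient_module_carrier)
  ultimately have "P (\<one>\<^bsub>R\<^esub> \<odot>\<^bsub>tensor R M N\<^esub> u)" by auto
  then show ?thesis using u by simp
qed

text \<open>The kernel of the linear extension of a bilinear map is a submodule that contains all relators,
  hence it contains their span.\<close>

lemma lin_ext_tensor_null:
  assumes M: "module R M" and N: "module R N" and P: "module R P"
    and f: "f \<in> bilinear_maps R M N P" and c: "c \<in> tensor_null R M N"
  shows "lin_ext R P (\<lambda>(x, y). f x y) c = \<zero>\<^bsub>P\<^esub>"
proof -
  interpret M: module R M by fact
  interpret N: module R N by fact
  interpret P: module R P by fact
  have R: "cring R" by unfold_locales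
  define F where "F = free_module R (carrier M \<times> carrier N)"
  have F: "module R F" unfolding F_def by (rule module_free_module[OF R])
  interpret F: module R F by fact
  define L where "L = lin_ext R P (\<lambda>(x, y). f x y)"
  have L: "L \<in> module_hom R F P"
    unfolding L_def F_def using bilinear_mapsD(3)[OF f] by (intro lin_ext_hom P) auto
  note Lc = module_hom_closed[OF L] and La = module_hom_add[OF L] and Ls = module_hom_smult[OF L]
  have Linv: "L (\<ominus>\<^bsub>F\<^esub> c) = \<ominus>\<^bsub>P\<^esub> L c" if "c \<in> carrier F" for c
    using that La[of "\<ominus>\<^bsub>F\<^esub> c" c] module_hom_zero[OF F P L] Lc
    by (metis F.M.add.inv_closed F.M.l_neg P.M.minus_equality)
  have g: "free_gen R (x, y) \<in> carrier F" "L (free_gen R (x, y)) = f x y"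
    if "x \<in> carrier M" "y \<in> carrier N" for x y
    using that bilinear_mapsD(3)[OF f] unfolding F_def L_def
    by (auto intro: free_gen_carrier[OF R] simp: lin_ext_gen[OF P])
  note fsimps = bilinear_mapsD(3)[OF f] module_hom_add[OF bilinear_mapsD(1)[OF f]]
    module_hom_add[OF bilinear_mapsD(2)[OF f]] module_hom_smult[OF bilinear_mapsD(1)[OF f]]
    module_hom_smult[OF bilinear_mapsD(2)[OF f]]
  let ?K = "{c \<in> carrier F. L c = \<zero>\<^bsub>P\<^esub>}"
  have "submodule ?K R F"
    by (rule F.submoduleI) (auto simp: module_hom_zero[OF F P L] La Ls Linv)
  moreover have "tensor_relators R M N \<subseteq> ?K"
    unfolding tensor_relators_def Let_def F_def[symmetric]
    by (auto simp: g La Ls Linv fsimps a_minus_def P.M.r_neg)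
  ultimately have "tensor_null R M N \<subseteq> ?K"
    unfolding tensor_null_def F_def[symmetric] by (rule module_span_least)
  then show ?thesis using c by (auto simp: L_def)
qed

text \<open>Two representatives of a tensor differ by an element on which the linear extension vanishes.
  Therefore the image in the definition of \<open>tensor_lift\<close> is a singleton.\<close>

lemma tensor_lift_coset:
  assumes M: "module R M" and N: "module R N" and P: "module R P"
    and f: "f \<in> bilinear_maps R M N P" and c: "c \<in> carrier (free_module R (carrier M \<times> carrier N))"
  shows "tensor_lift R P f (tensor_null R M N +>\<^bsub>free_module R (carrier M \<times> carrier N)\<^esub> c)
    = lin_ext R P (\<lambda>(x, y). f x y) c"
proof -
  interpret P: module R P by fact
  have R: "cring R" by unfold_locales
  define F where "F = free_module R (carrier M \<times> carrier N)"
  have F: "module R F" unfolding F_def by (rule module_free_module[OF R])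
  interpret F: module R F by fact
  note sub = tensor_null_submodule(1)[OF M N, folded F_def]
  interpret K: abelian_subgroup "tensor_null R M N" F by (rule submodule_abelian_subgroup[OF F sub])
  let ?L = "lin_ext R P (\<lambda>(x, y). f x y)"
  have L: "?L \<in> module_hom R F P"
    unfolding F_def using bilinear_mapsD(3)[OF f] by (intro lin_ext_hom P) auto
  have cF: "c \<in> carrier F" using c by (simp add: F_def)
  have "?L d = ?L c" if d: "d \<in> tensor_null R M N +>\<^bsub>F\<^esub> c" for d
  proof -
    obtain n where n: "n \<in> tensor_null R M N" "d = n \<oplus>\<^bsub>F\<^esub> c"
      using d by (auto simp: a_r_coset_def')
    then show ?thesis
      using lin_ext_tensor_null[OF M N P f n(1)] module_hom_add[OF L _ cF, of n] K.a_subset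
        module_hom_closed[OF L cF] by auto
  qed
  moreover have "c \<in> tensor_null R M N +>\<^bsub>F\<^esub> c" using cF by (rule K.a_rcos_self)
  ultimately have "?L ` (tensor_null R M N +>\<^bsub>F\<^esub> c) = {?L c}" by blast
  then show ?thesis by (simp add: tensor_lift_def F_def)
qed

lemma tensor_lift_pure:
  assumes M: "module R M" and N: "module R N" and P: "module R P"
    and f: "f \<in> bilinear_maps R M N P" and x: "x \<in> carrier M" and y: "y \<in> carrier N"
  shows "tensor_lift R P f (pure_tensor R M N x y) = f x y"
proof -
  interpret P: module R P by fact
  have "free_gen R (x, y) \<in> carrier (free_module R (carrier M \<times> carrier N))"
    using x y by (intro free_gen_carrier[OF P.R.is_cring]) auto
  then show ?thesis
    using lin_ext_gen[OF P, of "\<lambda>(x, y). f x y" "(x, y)"] bilinear_mapsD(3)[OF f x y]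
    by (simp add: pure_tensor_def tensor_lift_coset[OF M N P f])
qed

lemma tensor_lift_hom:
  assumes M: "module R M" and N: "module R N" and P: "module R P"
    and f: "f \<in> bilinear_maps R M N P"
  shows "tensor_lift R P f \<in> module_hom R (tensor R M N) P"
proof -
  interpret P: module R P by fact
  have R: "cring R" by unfold_locales
  define F where "F = free_module R (carrier M \<times> carrier N)"
  have F: "module R F" unfolding F_def by (rule module_free_module[OF R])
  interpret F: module R F by fact
  note sub = tensor_null_submodule(1)[OF M N, folded F_def]
  let ?L = "lin_ext R P (\<lambda>(x, y). f x y)"
  have L: "?L \<in> module_hom R F P"
    unfolding F_def using bilinear_mapsD(3)[OF f] by (intro lin_ext_hom P) auto
  note lift = tensor_lift_coset[OF M N P f, folded F_def]
  have T: "tensor R M N = quotient_module F (tensor_null R M N)" by (simp add: tensor_def F_def)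
  show ?thesis
    by (rule module_homI)
       (auto simp: T quotient_module_carrier quotient_module_add[OF F sub]
          quotient_module_smult[OF F sub] lift module_hom_closed[OF L] module_hom_add[OF L]
          module_hom_smult[OF L])
qed

lemma tensor_hom_eqI:
  assumes "module R M" "module R N"
    and f: "f \<in> module_hom R (tensor R M N) P" and g: "g \<in> module_hom R (tensor R M N) P"
    and eq: "\<And>x y. x \<in> carrier M \<Longrightarrow> y \<in> carrier N \<Longrightarrow>
      f (pure_tensor R M N x y) = g (pure_tensor R M N x y)"
    and u: "u \<in> carrier (tensor R M N)"
  shows "f u = g u"
  using assms(1,2) u
  by (induction rule: tensor_induct) (simp_all add: eq module_hom_add[OF f] module_hom_add[OF g])

lemma bilinear_maps_comp:
  assumes "f \<in> bilinear_maps R M' N' P" "g \<in> module_hom R M M'" "h \<in> module_hom R N N'"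
  shows "(\<lambda>x y. f (g x) (h y)) \<in> bilinear_maps R M N P"
proof (rule bilinear_mapsI)
  fix x assume "x \<in> carrier M"
  then show "(\<lambda>y. f (g x) (h y)) \<in> module_hom R N P"
    by (rule module_hom_comp[OF assms(3) bilinear_mapsD(1)[OF assms(1) module_hom_closed[OF assms(2)]]])
next
  fix y assume "y \<in> carrier N"
  then show "(\<lambda>x. f (g x) (h y)) \<in> module_hom R M P"
    by (rule module_hom_comp[OF assms(2) bilinear_mapsD(2)[OF assms(1) module_hom_closed[OF assms(3)]]])
qed

lemma bilinear_maps_post_comp:
  assumes "f \<in> bilinear_maps R M N P" "g \<in> module_hom R P Q"
  shows "(\<lambda>x y. g (f x y)) \<in> bilinear_maps R M N Q"
  by (rule bilinear_mapsI)
    (rule module_hom_comp[OF bilinear_mapsD(1)[OF assms(1)] assms(2)]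
       module_hom_comp[OF bilinear_mapsD(2)[OF assms(1)] assms(2)], assumption)+

lemma module_hom_sum:
  assumes "module R N" "f \<in> module_hom R M N" "g \<in> module_hom R M N"
  shows "(\<lambda>x. f x \<oplus>\<^bsub>N\<^esub> g x) \<in> module_hom R M N"
proof -
  interpret N: module R N by fact
  show ?thesis
    by (rule module_homI)
      (simp_all add: module_hom_closed[OF assms(2)] module_hom_closed[OF assms(3)]
        module_hom_add[OF assms(2)] module_hom_add[OF assms(3)]
        module_hom_smult[OF assms(2)] module_hom_smult[OF assms(3)]
        N.smult_r_distr N.M.a_ac)
qed

lemma bilinear_maps_sum:
  assumes "module R P" "f \<in> bilinear_maps R M N P" "g \<in> bilinear_maps R M N P"
  shows "(\<lambda>x y. f x y \<oplus>\<^bsub>P\<^esub> g x y) \<in> bilinear_maps R M N P"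
  by (rule bilinear_mapsI)
    (rule module_hom_sum[OF assms(1) bilinear_mapsD(1)[OF assms(2)] bilinear_mapsD(1)[OF assms(3)]]
       module_hom_sum[OF assms(1) bilinear_mapsD(2)[OF assms(2)] bilinear_mapsD(2)[OF assms(3)]],
      assumption, assumption)+

lemma bilinear_maps_linear:
  assumes "f \<in> bilinear_maps R M N P"
  shows "x \<in> carrier M \<Longrightarrow> x' \<in> carrier M \<Longrightarrow> y \<in> carrier N \<Longrightarrow>
      f (x \<oplus>\<^bsub>M\<^esub> x') y = f x y \<oplus>\<^bsub>P\<^esub> f x' y"
    and "x \<in> carrier M \<Longrightarrow> y \<in> carrier N \<Longrightarrow> y' \<in> carrier N \<Longrightarrow>
      f x (y \<oplus>\<^bsub>N\<^esub> y') = f x y \<oplus>\<^bsub>P\<^esub> f x y'"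
    and "r \<in> carrier R \<Longrightarrow> x \<in> carrier M \<Longrightarrow> y \<in> carrier N \<Longrightarrow>
      f (r \<odot>\<^bsub>M\<^esub> x) y = r \<odot>\<^bsub>P\<^esub> f x y"
    and "r \<in> carrier R \<Longrightarrow> x \<in> carrier M \<Longrightarrow> y \<in> carrier N \<Longrightarrow>
      f x (r \<odot>\<^bsub>N\<^esub> y) = r \<odot>\<^bsub>P\<^esub> f x y"
  using module_hom_add[OF bilinear_mapsD(2)[OF assms]] module_hom_add[OF bilinear_mapsD(1)[OF assms]]
    module_hom_smult[OF bilinear_mapsD(2)[OF assms]] module_hom_smult[OF bilinear_mapsD(1)[OF assms]]
  by auto

text \<open>A family of linear maps out of a tensor product is bilinear as soon as it is linear in
  the parameter on pure tensors.\<close>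

lemma bilinear_maps_from_tensor:
  assumes L: "module R L" and M: "module R M" and N: "module R N" and P: "module R P"
    and hom: "\<And>a. a \<in> carrier L \<Longrightarrow> f a \<in> module_hom R (tensor R M N) P"
    and lin: "\<And>x y. x \<in> carrier M \<Longrightarrow> y \<in> carrier N \<Longrightarrow>
      (\<lambda>a. f a (pure_tensor R M N x y)) \<in> module_hom R L P"
  shows "f \<in> bilinear_maps R L (tensor R M N) P"
proof (rule bilinear_mapsI)
  interpret P: module R P by fact
  interpret L: module R L by fact
  fix u assume "u \<in> carrier (tensor R M N)"
  with M N show "(\<lambda>a. f a u) \<in> module_hom R L P"
  proof (induction rule: tensor_induct)
    case (add u v)
    have "(\<lambda>a. f a u \<oplus>\<^bsub>P\<^esub> f a v) \<in> module_hom R L P"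
      using add by (intro module_hom_sum P)
    then show ?case
      using add(1,2) by (simp add: module_hom_def Pi_iff hom[THEN module_hom_add])
  qed (rule lin)
qed (rule hom)

lemma pure_tensor_hom:
  assumes "module R M" "module R N"
  shows "x \<in> carrier M \<Longrightarrow> pure_tensor R M N x \<in> module_hom R N (tensor R M N)"
    and "y \<in> carrier N \<Longrightarrow> (\<lambda>x. pure_tensor R M N x y) \<in> module_hom R M (tensor R M N)"
  using bilinear_mapsD[OF pure_tensor_bilinear[OF assms]] by auto

section \<open>Tensor products of maps and reassociation\<close>

lemma tensor_map_hom:
  assumes "module R M" "module R N" "module R M'" "module R N'"
    and "f \<in> module_hom R M M'" "g \<in> module_hom R N N'"
  shows "tensor_map R M' N' f g \<in> module_hom R (tensor R M N) (tensor R M' N')"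
  unfolding tensor_map_def
  by (intro tensor_lift_hom module_tensor assms bilinear_maps_comp[OF pure_tensor_bilinear])

lemma tensor_map_pure:
  assumes "module R M" "module R N" "module R M'" "module R N'"
    and "f \<in> module_hom R M M'" "g \<in> module_hom R N N'" "x \<in> carrier M" "y \<in> carrier N"
  shows "tensor_map R M' N' f g (pure_tensor R M N x y) = pure_tensor R M' N' (f x) (g y)"
  unfolding tensor_map_def
  by (intro tensor_lift_pure module_tensor assms bilinear_maps_comp[OF pure_tensor_bilinear])

lemma tensor_map_cong:
  assumes M: "module R M" "module R N" and M': "module R M'" "module R N'"
    and f: "f \<in> module_hom R M M'" "g \<in> module_hom R N N'"
    and f': "f' \<in> module_hom R M M'" "g' \<in> module_hom R N N'"
    and eq: "\<And>x. x \<in> carrier M \<Longrightarrow> f x = f' x" "\<And>y. y \<in> carrier N \<Longrightarrow> g y = g' y"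
    and u: "u \<in> carrier (tensor R M N)"
  shows "tensor_map R M' N' f g u = tensor_map R M' N' f' g' u"
  by (rule tensor_hom_eqI[OF M tensor_map_hom[OF M M' f] tensor_map_hom[OF M M' f'] _ u])
     (simp add: tensor_map_pure[OF M M' f] tensor_map_pure[OF M M' f'] eq)

lemma tensor_map_id:
  assumes M: "module R M" "module R N" and u: "u \<in> carrier (tensor R M N)"
  shows "tensor_map R M N id id u = u"
  using tensor_hom_eqI[OF M tensor_map_hom[OF M M module_hom_id module_hom_id] module_hom_id _ u]
  by (simp add: tensor_map_pure[OF M M module_hom_id module_hom_id])

text \<open>Linearity in the tensor \<open>u\<close> comes from the inner lift; linearity in \<open>z\<close> is checked on pure
  tensors only.\<close>

lemma tensor_assoc_bilinear:
  assumes M: "module R M" and N: "module R N" and P: "module R P"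
  shows "z \<in> carrier P \<Longrightarrow>
      (\<lambda>x y. pure_tensor R M (tensor R N P) x (pure_tensor R N P y z))
        \<in> bilinear_maps R M N (tensor R M (tensor R N P))" (is "_ \<Longrightarrow> ?B z")
    and "(\<lambda>u z. tensor_lift R (tensor R M (tensor R N P))
        (\<lambda>x y. pure_tensor R M (tensor R N P) x (pure_tensor R N P y z)) u)
      \<in> bilinear_maps R (tensor R M N) P (tensor R M (tensor R N P))"
proof -
  note NP = module_tensor[OF N P]
  note T = module_tensor[OF M NP]
  show B: "?B z" if "z \<in> carrier P" for z
    using bilinear_maps_comp[OF pure_tensor_bilinear[OF M NP] module_hom_id pure_tensor_hom(2)[OF N P that]]
    by simp
  have "(\<lambda>z u. tensor_lift R (tensor R M (tensor R N P))
        (\<lambda>x y. pure_tensor R M (tensor R N P) x (pure_tensor R N P y z)) u)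
      \<in> bilinear_maps R P (tensor R M N) (tensor R M (tensor R N P))"
  proof (rule bilinear_maps_from_tensor[OF P M N T])
    interpret P: module R P by (fact P)
    fix x y assume xy: "x \<in> carrier M" "y \<in> carrier N"
    then have "(\<lambda>z. pure_tensor R M (tensor R N P) x (pure_tensor R N P y z))
        \<in> module_hom R P (tensor R M (tensor R N P))"
      by (intro module_hom_comp[OF pure_tensor_hom(1)[OF N P]] pure_tensor_hom(1)[OF M NP])
    then show "(\<lambda>z. tensor_lift R (tensor R M (tensor R N P))
        (\<lambda>x y. pure_tensor R M (tensor R N P) x (pure_tensor R N P y z)) (pure_tensor R M N x y))
      \<in> module_hom R P (tensor R M (tensor R N P))"
      using xy by (simp add: module_hom_def Pi_iff tensor_lift_pure[OF M N T B])
  qed (rule tensor_lift_hom[OF M N T B])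
  then show "(\<lambda>u z. tensor_lift R (tensor R M (tensor R N P))
        (\<lambda>x y. pure_tensor R M (tensor R N P) x (pure_tensor R N P y z)) u)
      \<in> bilinear_maps R (tensor R M N) P (tensor R M (tensor R N P))"
    by (simp add: bilinear_maps_def)
qed

lemma tensor_assoc_hom:
  assumes "module R M" "module R N" "module R P"
  shows "tensor_assoc R M N P
    \<in> module_hom R (tensor R (tensor R M N) P) (tensor R M (tensor R N P))"
  unfolding tensor_assoc_def Let_def
  by (intro tensor_lift_hom tensor_assoc_bilinear module_tensor assms)

lemma tensor_assoc_pure:
  assumes M: "module R M" and N: "module R N" and P: "module R P"
    and "x \<in> carrier M" "y \<in> carrier N" "z \<in> carrier P"
  shows "tensor_assoc R M N P (pure_tensor R (tensor R M N) P (pure_tensor R M N x y) z)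
    = pure_tensor R M (tensor R N P) x (pure_tensor R N P y z)"
proof -
  note NP = module_tensor[OF N P]
  note T = module_tensor[OF M NP]
  show ?thesis
    using assms unfolding tensor_assoc_def Let_def
    by (simp add: tensor_lift_pure[OF module_tensor[OF M N] P T tensor_assoc_bilinear(2)[OF M N P]]
          tensor_lift_pure[OF M N T tensor_assoc_bilinear(1)[OF M N P]] pure_tensor_closed)
qed

lemma tensor_assoc_inv_bilinear:
  assumes M: "module R M" and N: "module R N" and P: "module R P"
  shows "x \<in> carrier M \<Longrightarrow>
      (\<lambda>y z. pure_tensor R (tensor R M N) P (pure_tensor R M N x y) z)
        \<in> bilinear_maps R N P (tensor R (tensor R M N) P)" (is "_ \<Longrightarrow> ?B x")
    and "(\<lambda>x. tensor_lift R (tensor R (tensor R M N) P)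
        (\<lambda>y z. pure_tensor R (tensor R M N) P (pure_tensor R M N x y) z))
      \<in> bilinear_maps R M (tensor R N P) (tensor R (tensor R M N) P)"
proof -
  note MN = module_tensor[OF M N]
  note T = module_tensor[OF MN P]
  show B: "?B x" if "x \<in> carrier M" for x
    using bilinear_maps_comp[OF pure_tensor_bilinear[OF MN P] pure_tensor_hom(1)[OF M N that] module_hom_id]
    by simp
  show "(\<lambda>x. tensor_lift R (tensor R (tensor R M N) P)
        (\<lambda>y z. pure_tensor R (tensor R M N) P (pure_tensor R M N x y) z))
      \<in> bilinear_maps R M (tensor R N P) (tensor R (tensor R M N) P)"
  proof (rule bilinear_maps_from_tensor[OF M N P T])
    interpret M: module R M by (fact M)
    fix y z assume yz: "y \<in> carrier N" "z \<in> carrier P"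
    then have "(\<lambda>x. pure_tensor R (tensor R M N) P (pure_tensor R M N x y) z)
        \<in> module_hom R M (tensor R (tensor R M N) P)"
      by (intro module_hom_comp[OF pure_tensor_hom(2)[OF M N]] pure_tensor_hom(2)[OF MN P])
    then show "(\<lambda>x. tensor_lift R (tensor R (tensor R M N) P)
        (\<lambda>y z. pure_tensor R (tensor R M N) P (pure_tensor R M N x y) z) (pure_tensor R N P y z))
      \<in> module_hom R M (tensor R (tensor R M N) P)"
      using yz by (simp add: module_hom_def Pi_iff tensor_lift_pure[OF N P T B])
  qed (rule tensor_lift_hom[OF N P T B])
qed

lemma tensor_assoc_inv_hom:
  assumes "module R M" "module R N" "module R P"
  shows "tensor_assoc_inv R M N P
    \<in> module_hom R (tensor R M (tensor R N P)) (tensor R (tensor R M N) P)"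
  unfolding tensor_assoc_inv_def Let_def
  by (intro tensor_lift_hom tensor_assoc_inv_bilinear module_tensor assms)

lemma tensor_assoc_inv_pure:
  assumes M: "module R M" and N: "module R N" and P: "module R P"
    and "x \<in> carrier M" "y \<in> carrier N" "z \<in> carrier P"
  shows "tensor_assoc_inv R M N P (pure_tensor R M (tensor R N P) x (pure_tensor R N P y z))
    = pure_tensor R (tensor R M N) P (pure_tensor R M N x y) z"
proof -
  note MN = module_tensor[OF M N]
  note T = module_tensor[OF MN P]
  show ?thesis
    using assms unfolding tensor_assoc_inv_def Let_def
    by (simp add: tensor_lift_pure[OF M module_tensor[OF N P] T tensor_assoc_inv_bilinear(2)[OF M N P]]
          tensor_lift_pure[OF N P T tensor_assoc_inv_bilinear(1)[OF M N P]] pure_tensor_closed)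
qed

lemma tensor_map_left_bilinear:
  assumes K: "module R K" and M: "module R M" and N: "module R N"
    and m: "m \<in> bilinear_maps R K M M"
  shows "(\<lambda>a. tensor_map R M N (m a) id) \<in> bilinear_maps R K (tensor R M N) (tensor R M N)"
proof (rule bilinear_maps_from_tensor[OF K M N module_tensor[OF M N]])
  note ma = bilinear_mapsD(1)[OF m]
  show "tensor_map R M N (m a) id \<in> module_hom R (tensor R M N) (tensor R M N)"
    if "a \<in> carrier K" for a
    by (rule tensor_map_hom[OF M N M N ma[OF that] module_hom_id])
  fix x y assume xy: "x \<in> carrier M" "y \<in> carrier N"
  interpret K: module R K by fact
  have "(\<lambda>a. pure_tensor R M N (m a x) y) \<in> module_hom R K (tensor R M N)"
    by (rule module_hom_comp[OF bilinear_mapsD(2)[OF m xy(1)] pure_tensor_hom(2)[OF M N xy(2)]])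
  then show "(\<lambda>a. tensor_map R M N (m a) id (pure_tensor R M N x y)) \<in> module_hom R K (tensor R M N)"
    using xy by (simp add: module_hom_def Pi_iff tensor_map_pure[OF M N M N ma module_hom_id])
qed

lemma tensor_map_right_bilinear:
  assumes K: "module R K" and M: "module R M" and N: "module R N"
    and m: "m \<in> bilinear_maps R N K N"
  shows "(\<lambda>b. tensor_map R M N id (\<lambda>v. m v b)) \<in> bilinear_maps R K (tensor R M N) (tensor R M N)"
proof (rule bilinear_maps_from_tensor[OF K M N module_tensor[OF M N]])
  note mb = bilinear_mapsD(2)[OF m]
  show "tensor_map R M N id (\<lambda>v. m v b) \<in> module_hom R (tensor R M N) (tensor R M N)"
    if "b \<in> carrier K" for b
    by (rule tensor_map_hom[OF M N M N module_hom_id mb[OF that]])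
  fix x y assume xy: "x \<in> carrier M" "y \<in> carrier N"
  interpret K: module R K by fact
  have "(\<lambda>b. pure_tensor R M N x (m y b)) \<in> module_hom R K (tensor R M N)"
    by (rule module_hom_comp[OF bilinear_mapsD(1)[OF m xy(2)] pure_tensor_hom(1)[OF M N xy(1)]])
  then show "(\<lambda>b. tensor_map R M N id (\<lambda>v. m v b) (pure_tensor R M N x y)) \<in> module_hom R K (tensor R M N)"
    using xy by (simp add: module_hom_def Pi_iff tensor_map_pure[OF M N M N module_hom_id mb])
qed

section \<open>Actions of an algebra on its tensor square\<close>

text \<open>For an arbitrary binary operation \<open>m\<close>, these are \<open>a \<cdot> (u \<otimes> v) = m a u \<otimes> v\<close> and
  \<open>(u \<otimes> v) \<cdot> b = u \<otimes> m v b\<close>. With the product for \<open>m\<close> they are the two actions in the Leibniz rule,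
  with \<open>vee\<close> the two operations in the coproduct of a grafting.\<close>

definition left_action where
  "left_action R M m a = tensor_map R M M (m a) id"

definition right_action where
  "right_action R M m b = tensor_map R M M id (\<lambda>v. m v b)"

context module
begin

abbreviation "T2 \<equiv> tensor R M M"
abbreviation "T3 \<equiv> tensor R M (tensor R M M)"
abbreviation "pure \<equiv> pure_tensor R M M"
abbreviation "pure3 \<equiv> pure_tensor R M (tensor R M M)"

lemma mods: "module R M" "module R T2" "module R T3"
    "module R (tensor R T2 M)"
  by (intro module_tensor module_axioms)+

lemma T2_add_closed: "u \<in> carrier T2 \<Longrightarrow> v \<in> carrier T2 \<Longrightarrow> u \<oplus>\<^bsub>T2\<^esub> v \<in> carrier T2"
proof -
  interpret T2: module R T2 by (rule mods)
  show "u \<in> carrier T2 \<Longrightarrow> v \<in> carrier T2 \<Longrightarrow> ?thesis" by simp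
qed

lemmas pure_bilinear = pure_tensor_bilinear[OF mods(1) mods(1)]
  and pure3_bilinear = pure_tensor_bilinear[OF mods(1) mods(2)]

lemma left_action_bilinear:
  "m \<in> bilinear_maps R M M M \<Longrightarrow> left_action R M m \<in> bilinear_maps R M T2 T2"
  using tensor_map_left_bilinear[OF mods(1) mods(1) mods(1)] by (simp add: left_action_def[abs_def])

lemma right_action_bilinear:
  "m \<in> bilinear_maps R M M M \<Longrightarrow> right_action R M m \<in> bilinear_maps R M T2 T2"
  using tensor_map_right_bilinear[OF mods(1) mods(1) mods(1)] by (simp add: right_action_def[abs_def])

lemma left_action_pure:
  "m \<in> bilinear_maps R M M M \<Longrightarrow> a \<in> carrier M \<Longrightarrow> x \<in> carrier M \<Longrightarrow> y \<in> carrier M \<Longrightarrow>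
    left_action R M m a (pure x y) = pure (m a x) y"
  unfolding left_action_def
  by (simp add: tensor_map_pure[OF mods(1) mods(1) mods(1) mods(1) bilinear_mapsD(1) module_hom_id])

lemma right_action_pure:
  "m \<in> bilinear_maps R M M M \<Longrightarrow> b \<in> carrier M \<Longrightarrow> x \<in> carrier M \<Longrightarrow> y \<in> carrier M \<Longrightarrow>
    right_action R M m b (pure x y) = pure x (m y b)"
  unfolding right_action_def
  by (simp add: tensor_map_pure[OF mods(1) mods(1) mods(1) mods(1) module_hom_id bilinear_mapsD(2)])

lemma T2_eqI:
  assumes "f \<in> module_hom R T2 P" "g \<in> module_hom R T2 P"
    and "\<And>x y. x \<in> carrier M \<Longrightarrow> y \<in> carrier M \<Longrightarrow> f (pure x y) = g (pure x y)"
    and "u \<in> carrier T2"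
  shows "f u = g u"
  by (rule tensor_hom_eqI[OF mods(1) mods(1) assms])

text \<open>The reassociations only make room for \<open>vee\<close> to be applied to adjacent factors. On pure tensors
  they cancel, which leaves the two actions; every later argument uses this form.\<close>

lemma vee_coproduct_eq:
  assumes m: "m \<in> bilinear_maps R M M M" and x: "x \<in> carrier M" and y: "y \<in> carrier M"
    and u: "u \<in> carrier T2" and v: "v \<in> carrier T2"
  shows "vee_coproduct R M m x y u v = pure x y \<oplus>\<^bsub>T2\<^esub> right_action R M m y u \<oplus>\<^bsub>T2\<^esub> left_action R M m x v"
proof -
  have lift: "tensor_lift R M m \<in> module_hom R T2 M"
    by (rule tensor_lift_hom[OF mods(1) mods(1) mods(1) m])
  note liftp = tensor_lift_pure[OF mods(1) mods(1) mods(1) m]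
  have "tensor_map R M M id (tensor_lift R M m) (tensor_assoc R M M M (pure_tensor R T2 M u y))
      = right_action R M m y u"
    by (rule T2_eqI[OF module_hom_comp[OF module_hom_comp[OF pure_tensor_hom(2)[OF mods(2,1) y]
            tensor_assoc_hom[OF mods(1) mods(1) mods(1)]]
            tensor_map_hom[OF mods(1) mods(2) mods(1) mods(1) module_hom_id lift]]
          bilinear_mapsD(1)[OF right_action_bilinear[OF m] y] _ u])
       (simp add: tensor_assoc_pure[OF mods(1) mods(1) mods(1)] y pure_tensor_closed mods
          tensor_map_pure[OF mods(1) mods(2) mods(1) mods(1) module_hom_id lift] liftp right_action_pure[OF m])
  moreover have "tensor_map R M M (tensor_lift R M m) id (tensor_assoc_inv R M M M (pure3 x v))
      = left_action R M m x v"
    by (rule T2_eqI[OF module_hom_comp[OF module_hom_comp[OF pure_tensor_hom(1)[OF mods(1,2) x]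
            tensor_assoc_inv_hom[OF mods(1) mods(1) mods(1)]]
            tensor_map_hom[OF mods(2) mods(1) mods(1) mods(1) lift module_hom_id]]
          bilinear_mapsD(1)[OF left_action_bilinear[OF m] x] _ v])
       (simp add: tensor_assoc_inv_pure[OF mods(1) mods(1) mods(1)] x pure_tensor_closed mods
          tensor_map_pure[OF mods(2) mods(1) mods(1) mods(1) lift module_hom_id] liftp left_action_pure[OF m])
  ultimately show ?thesis by (simp add: vee_coproduct_def)
qed

end

section \<open>Coproducts compatible with grafting\<close>

text \<open>The setting in which the Leibniz rule and coassociativity are propagated along \<open>vee\<close>: all the
  axioms of the bialgebra except these two.\<close>

locale under_vee_coproduct = unitary_under_vee_algebra R H vee
  for R (structure) and H (structure) and vee +
  fixes \<Delta>
  assumes coproduct_linear: "\<Delta> \<in> module_hom R H (tensor R H H)"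
    and coproduct_vee:
      "\<lbrakk>x \<in> carrier H; y \<in> carrier H\<rbrakk> \<Longrightarrow>
        \<Delta> (vee x y) = vee_coproduct R H vee x y (\<Delta> x) (\<Delta> y)"
begin

abbreviation "graft_left \<equiv> left_action R H vee"
abbreviation "graft_right \<equiv> right_action R H vee"

lemmas graft_left_bilinear = left_action_bilinear[OF vee_bilinear]
  and graft_right_bilinear = right_action_bilinear[OF vee_bilinear]

lemmas graft_left_pure = left_action_pure[OF vee_bilinear]
  and graft_right_pure = right_action_pure[OF vee_bilinear]

lemmas vee_closed = bilinear_mapsD(3)[OF vee_bilinear]
  and coproduct_closed = module_hom_closed[OF coproduct_linear]
  and graft_left_closed = bilinear_mapsD(3)[OF graft_left_bilinear]
  and graft_right_closed = bilinear_mapsD(3)[OF graft_right_bilinear]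

lemma coproduct_graft:
  assumes "x \<in> carrier H" "y \<in> carrier H"
  shows "\<Delta> (vee x y) = pure x y \<oplus>\<^bsub>T2\<^esub> graft_right y (\<Delta> x) \<oplus>\<^bsub>T2\<^esub> graft_left x (\<Delta> y)"
  using assms by (simp add: coproduct_vee vee_coproduct_eq[OF vee_bilinear] coproduct_closed)

text \<open>The map \<open>(a \<otimes> b, y) \<mapsto> a \<otimes> (b \<otimes> y)\<close>.\<close>

definition snoc where "snoc u y = tensor_assoc R H H H (pure_tensor R T2 H u y)"

text \<open>\<open>(\<Delta> \<otimes> id)\<close> and \<open>(id \<otimes> \<Delta>)\<close>, both with values in \<open>H \<otimes> (H \<otimes> H)\<close>; coassociativity says that
  they agree on the image of \<open>\<Delta>\<close>.\<close>

definition coproduct_left where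
  "coproduct_left u = tensor_assoc R H H H (tensor_map R T2 H \<Delta> id u)"

definition coproduct_right where
  "coproduct_right = tensor_map R H T2 id \<Delta>"

definition graft_left3 where "graft_left3 x = tensor_map R H T2 (vee x) id"
definition graft_right3 where "graft_right3 y = tensor_map R H T2 id (graft_right y)"

text \<open>The map \<open>(a \<otimes> b, c \<otimes> d) \<mapsto> a \<otimes> (vee b c \<otimes> d)\<close>. In both iterated coproducts of \<open>vee x y\<close> it
  accounts for the term in which \<open>x\<close> and \<open>y\<close> are each comultiplied once.\<close>

definition middle where "middle v u = tensor_map R H T2 id (\<lambda>b. graft_left b u) v"

lemma snoc_bilinear: "snoc \<in> bilinear_maps R T2 H T3"
  unfolding snoc_def[abs_def]
  by (rule bilinear_maps_post_comp[OF pure_tensor_bilinear[OF mods(2,1)]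
      tensor_assoc_hom[OF mods(1) mods(1) mods(1)]])

lemma snoc_pure:
  "a \<in> carrier H \<Longrightarrow> b \<in> carrier H \<Longrightarrow> y \<in> carrier H \<Longrightarrow> snoc (pure a b) y = pure3 a (pure b y)"
  by (simp add: snoc_def tensor_assoc_pure[OF mods(1) mods(1) mods(1)])

lemma coproduct_left_hom: "coproduct_left \<in> module_hom R T2 T3"
  unfolding coproduct_left_def[abs_def]
  by (rule module_hom_comp[OF tensor_map_hom[OF mods(1) mods(1) mods(2) mods(1) coproduct_linear module_hom_id]
      tensor_assoc_hom[OF mods(1) mods(1) mods(1)]])

lemma coproduct_left_pure:
  "a \<in> carrier H \<Longrightarrow> b \<in> carrier H \<Longrightarrow> coproduct_left (pure a b) = snoc (\<Delta> a) b"
  by (simp add: coproduct_left_def snoc_def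
      tensor_map_pure[OF mods(1) mods(1) mods(2) mods(1) coproduct_linear module_hom_id])

lemma coproduct_right_hom: "coproduct_right \<in> module_hom R T2 T3"
  unfolding coproduct_right_def
  by (rule tensor_map_hom[OF mods(1) mods(1) mods(1) mods(2) module_hom_id coproduct_linear])

lemma coproduct_right_pure:
  "a \<in> carrier H \<Longrightarrow> b \<in> carrier H \<Longrightarrow> coproduct_right (pure a b) = pure3 a (\<Delta> b)"
  by (simp add: coproduct_right_def
      tensor_map_pure[OF mods(1) mods(1) mods(1) mods(2) module_hom_id coproduct_linear])

lemma graft_left3_hom: "x \<in> carrier H \<Longrightarrow> graft_left3 x \<in> module_hom R T3 T3"
  unfolding graft_left3_def
  by (rule tensor_map_hom[OF mods(1) mods(2) mods(1) mods(2) bilinear_mapsD(1)[OF vee_bilinear] module_hom_id])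

lemma graft_left3_pure:
  "x \<in> carrier H \<Longrightarrow> a \<in> carrier H \<Longrightarrow> u \<in> carrier T2 \<Longrightarrow> graft_left3 x (pure3 a u) = pure3 (vee x a) u"
  by (simp add: graft_left3_def
      tensor_map_pure[OF mods(1) mods(2) mods(1) mods(2) bilinear_mapsD(1)[OF vee_bilinear] module_hom_id])

lemma graft_right3_hom: "y \<in> carrier H \<Longrightarrow> graft_right3 y \<in> module_hom R T3 T3"
  unfolding graft_right3_def
  by (rule tensor_map_hom[OF mods(1) mods(2) mods(1) mods(2) module_hom_id bilinear_mapsD(1)[OF graft_right_bilinear]])

lemma graft_right3_pure:
  "y \<in> carrier H \<Longrightarrow> a \<in> carrier H \<Longrightarrow> u \<in> carrier T2 \<Longrightarrow> graft_right3 y (pure3 a u) = pure3 a (graft_right y u)"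
  by (simp add: graft_right3_def
      tensor_map_pure[OF mods(1) mods(2) mods(1) mods(2) module_hom_id bilinear_mapsD(1)[OF graft_right_bilinear]])

lemma middle_hom: "u \<in> carrier T2 \<Longrightarrow> (\<lambda>v. middle v u) \<in> module_hom R T2 T3"
  unfolding middle_def
  by (rule tensor_map_hom[OF mods(1) mods(1) mods(1) mods(2) module_hom_id bilinear_mapsD(2)[OF graft_left_bilinear]])

lemma middle_pure:
  "a \<in> carrier H \<Longrightarrow> b \<in> carrier H \<Longrightarrow> u \<in> carrier T2 \<Longrightarrow> middle (pure a b) u = pure3 a (graft_left b u)"
  by (simp add: middle_def
      tensor_map_pure[OF mods(1) mods(1) mods(1) mods(2) module_hom_id bilinear_mapsD(2)[OF graft_left_bilinear]])

lemma middle_bilinear: "(\<lambda>u v. middle v u) \<in> bilinear_maps R T2 T2 T3"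
proof (rule bilinear_maps_from_tensor[OF mods(2) mods(1) mods(1) mods(3) middle_hom])
  fix a b assume ab: "a \<in> carrier H" "b \<in> carrier H"
  interpret T2: module R T2 by (rule mods)
  have "(\<lambda>u. pure3 a (graft_left b u)) \<in> module_hom R T2 T3"
    by (rule module_hom_comp[OF bilinear_mapsD(1)[OF graft_left_bilinear ab(2)] pure_tensor_hom(1)[OF mods(1,2) ab(1)]])
  then show "(\<lambda>u. middle (pure a b) u) \<in> module_hom R T2 T3"
    using ab by (simp add: module_hom_def Pi_iff middle_pure)
qed

lemmas coalgebra_closed = bilinear_mapsD(3)[OF snoc_bilinear] bilinear_mapsD(3)[OF middle_bilinear]
  module_hom_closed[OF coproduct_left_hom] module_hom_closed[OF coproduct_right_hom]
  module_hom_closed[OF graft_left3_hom] module_hom_closed[OF graft_right3_hom]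
  pure_tensor_closed[OF mods(1) mods(2)] pure_tensor_closed[OF mods(1) mods(1)]
  vee_closed coproduct_closed graft_left_closed graft_right_closed

lemma snoc_vee:
  assumes u: "u \<in> carrier T2" and b: "b \<in> carrier H" and y: "y \<in> carrier H"
  shows "snoc u (vee b y) = graft_right3 y (snoc u b)"
  by (rule T2_eqI[OF bilinear_mapsD(2)[OF snoc_bilinear vee_closed[OF b y]]
        module_hom_comp[OF bilinear_mapsD(2)[OF snoc_bilinear b] graft_right3_hom[OF y]] _ u])
     (simp add: b y snoc_pure coalgebra_closed graft_right3_pure graft_right_pure)

lemma snoc_graft_right:
  assumes u: "u \<in> carrier T2" and a: "a \<in> carrier H" and b: "b \<in> carrier H"
  shows "snoc (graft_right a u) b = middle u (pure a b)"
  by (rule T2_eqI[OF module_hom_comp[OF bilinear_mapsD(1)[OF graft_right_bilinear a]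
          bilinear_mapsD(2)[OF snoc_bilinear b]] middle_hom[OF pure_tensor_closed[OF mods(1) mods(1) a b]] _ u])
     (simp add: a b snoc_pure coalgebra_closed graft_right_pure middle_pure graft_left_pure)

lemma snoc_graft_left:
  assumes u: "u \<in> carrier T2" and x: "x \<in> carrier H" and b: "b \<in> carrier H"
  shows "snoc (graft_left x u) b = graft_left3 x (snoc u b)"
  by (rule T2_eqI[OF module_hom_comp[OF bilinear_mapsD(1)[OF graft_left_bilinear x]
          bilinear_mapsD(2)[OF snoc_bilinear b]]
        module_hom_comp[OF bilinear_mapsD(2)[OF snoc_bilinear b] graft_left3_hom[OF x]] _ u])
     (simp add: x b snoc_pure coalgebra_closed graft_left_pure graft_left3_pure)

lemma coproduct_left_graft_right:
  assumes y: "y \<in> carrier H" and u: "u \<in> carrier T2"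
  shows "coproduct_left (graft_right y u) = graft_right3 y (coproduct_left u)"
  by (rule T2_eqI[OF module_hom_comp[OF bilinear_mapsD(1)[OF graft_right_bilinear y] coproduct_left_hom]
        module_hom_comp[OF coproduct_left_hom graft_right3_hom[OF y]] _ u])
     (simp add: y coalgebra_closed graft_right_pure coproduct_left_pure snoc_vee)

lemma coproduct_right_graft_left:
  assumes x: "x \<in> carrier H" and u: "u \<in> carrier T2"
  shows "coproduct_right (graft_left x u) = graft_left3 x (coproduct_right u)"
  by (rule T2_eqI[OF module_hom_comp[OF bilinear_mapsD(1)[OF graft_left_bilinear x] coproduct_right_hom]
        module_hom_comp[OF coproduct_right_hom graft_left3_hom[OF x]] _ u])
     (simp add: x coalgebra_closed graft_left_pure coproduct_right_pure graft_left3_pure)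

text \<open>Here \<open>\<Delta>\<close> meets the grafted factor: on \<open>u = a \<otimes> b\<close> it is applied to \<open>vee x a\<close>, whose three
  terms give the three summands.\<close>

lemma coproduct_left_graft_left:
  assumes x: "x \<in> carrier H" and u: "u \<in> carrier T2"
  shows "coproduct_left (graft_left x u) =
    pure3 x u \<oplus>\<^bsub>T3\<^esub> middle (\<Delta> x) u \<oplus>\<^bsub>T3\<^esub> graft_left3 x (coproduct_left u)"
  by (rule T2_eqI[OF module_hom_comp[OF bilinear_mapsD(1)[OF graft_left_bilinear x] coproduct_left_hom]
        module_hom_sum[OF mods(3) module_hom_sum[OF mods(3) pure_tensor_hom(1)[OF mods(1,2) x]
          bilinear_mapsD(2)[OF middle_bilinear coproduct_closed[OF x]]]
          module_hom_comp[OF coproduct_left_hom graft_left3_hom[OF x]]] _ u])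
     (simp add: x coalgebra_closed graft_left_pure coproduct_left_pure coproduct_graft snoc_pure snoc_graft_right snoc_graft_left
        bilinear_maps_linear(1)[OF snoc_bilinear] T2_add_closed)

text \<open>The mirror image: on \<open>u = a \<otimes> b\<close> the coproduct is applied to \<open>vee b y\<close>.\<close>

lemma coproduct_right_graft_right:
  assumes y: "y \<in> carrier H" and u: "u \<in> carrier T2"
  shows "coproduct_right (graft_right y u) =
    snoc u y \<oplus>\<^bsub>T3\<^esub> graft_right3 y (coproduct_right u) \<oplus>\<^bsub>T3\<^esub> middle u (\<Delta> y)"
  by (rule T2_eqI[OF module_hom_comp[OF bilinear_mapsD(1)[OF graft_right_bilinear y] coproduct_right_hom]
        module_hom_sum[OF mods(3) module_hom_sum[OF mods(3) bilinear_mapsD(2)[OF snoc_bilinear y]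
          module_hom_comp[OF coproduct_right_hom graft_right3_hom[OF y]]]
          middle_hom[OF coproduct_closed[OF y]]] _ u])
     (simp add: y coalgebra_closed graft_right_pure coproduct_right_pure coproduct_graft snoc_pure graft_right3_pure middle_pure
        bilinear_maps_linear(2)[OF pure3_bilinear] T2_add_closed)

text \<open>With \<open>\<Delta> (vee x y) = x \<otimes> y + \<Delta> x \<cdot> y + x \<cdot> \<Delta> y\<close>, both sides expand into the same five terms:
  \<open>\<Delta> x \<otimes> y\<close>, \<open>x \<otimes> \<Delta> y\<close>, the mixed term \<open>middle (\<Delta> x) (\<Delta> y)\<close>, and the two terms in which only
  \<open>x\<close> or only \<open>y\<close> is comultiplied twice. The last two agree by coassociativity on \<open>x\<close> and on \<open>y\<close>.\<close>

lemma coassociative_graft: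
  assumes x: "x \<in> carrier H" and y: "y \<in> carrier H"
    and cx: "coproduct_left (\<Delta> x) = coproduct_right (\<Delta> x)"
    and cy: "coproduct_left (\<Delta> y) = coproduct_right (\<Delta> y)"
  shows "coproduct_left (\<Delta> (vee x y)) = coproduct_right (\<Delta> (vee x y))"
proof -
  interpret T2: module R T2 by (rule mods)
  interpret T3: module R T3 by (rule mods)
  show ?thesis
    using x y
    by (simp add: coproduct_graft coalgebra_closed module_hom_add[OF coproduct_left_hom]
        module_hom_add[OF coproduct_right_hom] coproduct_left_pure coproduct_right_pure
        coproduct_left_graft_right coproduct_right_graft_right coproduct_left_graft_left coproduct_right_graft_left cx cy T3.M.a_ac)
qed

lemma mult_bilinear: "(\<otimes>\<^bsub>H\<^esub>) \<in> bilinear_maps R H H H"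
  by (intro bilinear_mapsI module_homI)
     (simp_all add: r_distr l_distr smult_mult_left smult_mult_right)

lemmas left_mult_bilinear = left_action_bilinear[OF mult_bilinear]
  and right_mult_bilinear = right_action_bilinear[OF mult_bilinear]
  and left_mult_pure = left_action_pure[OF mult_bilinear]
  and right_mult_pure = right_action_pure[OF mult_bilinear]

lemmas mult_closed = bilinear_mapsD(3)[OF mult_bilinear]
  and left_mult_closed = bilinear_mapsD(3)[OF left_mult_bilinear]
  and right_mult_closed = bilinear_mapsD(3)[OF right_mult_bilinear]

abbreviation "lmul \<equiv> left_action R H (\<otimes>\<^bsub>H\<^esub>)"
abbreviation "rmul \<equiv> right_action R H (\<otimes>\<^bsub>H\<^esub>)"

lemma graft_left_lmul:
  assumes x: "x \<in> carrier H" and y: "y \<in> carrier H" and u: "u \<in> carrier T2"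
  shows "graft_left x (lmul y u) = lmul (vee x y) u"
  by (rule T2_eqI[OF module_hom_comp[OF bilinear_mapsD(1)[OF left_mult_bilinear y] bilinear_mapsD(1)[OF graft_left_bilinear x]]
        bilinear_mapsD(1)[OF left_mult_bilinear vee_closed[OF x y]] _ u])
     (simp add: x y coalgebra_closed mult_closed left_mult_pure graft_left_pure vee_mult)

lemma rmul_graft_left:
  assumes x: "x \<in> carrier H" and z: "z \<in> carrier H" and u: "u \<in> carrier T2"
  shows "rmul z (graft_left x u) = graft_left x (rmul z u)"
  by (rule T2_eqI[OF module_hom_comp[OF bilinear_mapsD(1)[OF graft_left_bilinear x] bilinear_mapsD(1)[OF right_mult_bilinear z]]
        module_hom_comp[OF bilinear_mapsD(1)[OF right_mult_bilinear z] bilinear_mapsD(1)[OF graft_left_bilinear x]] _ u])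
     (simp add: x z coalgebra_closed mult_closed right_mult_pure graft_left_pure)

lemma rmul_graft_right:
  assumes y: "y \<in> carrier H" and z: "z \<in> carrier H" and u: "u \<in> carrier T2"
  shows "rmul z (graft_right y u) = graft_right (y \<otimes>\<^bsub>H\<^esub> z) u"
  by (rule T2_eqI[OF module_hom_comp[OF bilinear_mapsD(1)[OF graft_right_bilinear y] bilinear_mapsD(1)[OF right_mult_bilinear z]]
        bilinear_mapsD(1)[OF graft_right_bilinear mult_closed[OF y z]] _ u])
     (simp add: y z coalgebra_closed mult_closed right_mult_pure graft_right_pure vee_mult)

text \<open>Since \<open>vee x y * z = vee x (y * z)\<close>, the rule for \<open>vee\<close> reduces the left-hand side to
  \<open>\<Delta> (y * z)\<close>. The three exchange laws above sort the resulting terms, because multiplication on the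
  right acts on the second argument of \<open>vee\<close> only.\<close>

lemma leibniz_graft:
  assumes x: "x \<in> carrier H" and y: "y \<in> carrier H" and z: "z \<in> carrier H"
    and leibniz: "\<Delta> (y \<otimes>\<^bsub>H\<^esub> z) = lmul y (\<Delta> z) \<oplus>\<^bsub>T2\<^esub> rmul z (\<Delta> y)"
  shows "\<Delta> (vee x y \<otimes>\<^bsub>H\<^esub> z) = lmul (vee x y) (\<Delta> z) \<oplus>\<^bsub>T2\<^esub> rmul z (\<Delta> (vee x y))"
proof -
  interpret T2: module R T2 by (rule mods)
  show ?thesis
    using x y z
    by (simp add: vee_mult coproduct_graft leibniz coalgebra_closed mult_closed left_mult_closed right_mult_closed
        bilinear_maps_linear(2)[OF graft_left_bilinear] bilinear_maps_linear(2)[OF right_mult_bilinear]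
        right_mult_pure graft_left_lmul rmul_graft_left rmul_graft_right T2.M.a_ac)
qed

end

text \<open>The Leibniz rule for \<open>1 = 1 * 1\<close> reads \<open>\<Delta> 1 = \<Delta> 1 + \<Delta> 1\<close>.\<close>

lemma (in unitary_infinitesimal_bialgebra) coproduct_one: "\<Delta> \<one>\<^bsub>A\<^esub> = \<zero>\<^bsub>tensor R A A\<^esub>"
proof -
  interpret T2: module R T2 by (rule mods)
  have D: "\<Delta> \<one>\<^bsub>A\<^esub> \<in> carrier T2"
    by (rule module_hom_closed[OF coproduct_linear]) simp
  have l: "(\<lambda>u. \<one>\<^bsub>A\<^esub> \<otimes>\<^bsub>A\<^esub> u) \<in> module_hom R A A" and r: "(\<lambda>v. v \<otimes>\<^bsub>A\<^esub> \<one>\<^bsub>A\<^esub>) \<in> module_hom R A A"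
    by (auto simp: module_hom_def)
  note id = tensor_map_id[OF mods(1) mods(1) D]
  have "tensor_map R A A (\<lambda>u. \<one>\<^bsub>A\<^esub> \<otimes>\<^bsub>A\<^esub> u) id (\<Delta> \<one>\<^bsub>A\<^esub>) = tensor_map R A A id id (\<Delta> \<one>\<^bsub>A\<^esub>)"
    by (rule tensor_map_cong[OF mods(1) mods(1) mods(1) mods(1) l module_hom_id module_hom_id module_hom_id _ _ D])
      simp_all
  moreover have "tensor_map R A A id (\<lambda>v. v \<otimes>\<^bsub>A\<^esub> \<one>\<^bsub>A\<^esub>) (\<Delta> \<one>\<^bsub>A\<^esub>) = tensor_map R A A id id (\<Delta> \<one>\<^bsub>A\<^esub>)"
    by (rule tensor_map_cong[OF mods(1) mods(1) mods(1) mods(1) module_hom_id r module_hom_id module_hom_id _ _ D])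
      simp_all
  ultimately have "\<Delta> \<one>\<^bsub>A\<^esub> = \<Delta> \<one>\<^bsub>A\<^esub> \<oplus>\<^bsub>T2\<^esub> \<Delta> \<one>\<^bsub>A\<^esub>"
    using coproduct_mult[of "\<one>\<^bsub>A\<^esub>" "\<one>\<^bsub>A\<^esub>"] by (simp add: id)
  then show ?thesis using D by (metis T2.M.add.l_cancel_one')
qed

lemma under_vee_bialgebra_coproduct:
  assumes "unitary_infinitesimal_under_vee_bialgebra R H \<Delta> vee"
  shows "under_vee_coproduct R H vee \<Delta>"
proof -
  interpret unitary_infinitesimal_under_vee_bialgebra R H \<Delta> vee by fact
  show ?thesis
    by unfold_locales (fact coproduct_linear, fact coproduct_vee)
qed

lemma tensor_map_left_action:
  assumes M: "module R M" and N: "module R N" and f: "f \<in> module_hom R M N"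
    and m: "m \<in> bilinear_maps R M M M" and n: "n \<in> bilinear_maps R N N N"
    and fm: "\<And>y. y \<in> carrier M \<Longrightarrow> f (m x y) = n (f x) (f y)"
    and x: "x \<in> carrier M" and u: "u \<in> carrier (tensor R M M)"
  shows "tensor_map R N N f f (left_action R M m x u) = left_action R N n (f x) (tensor_map R N N f f u)"
proof -
  interpret M: module R M by fact
  interpret N: module R N by fact
  note fx = module_hom_closed[OF f]
  note ff = tensor_map_hom[OF M M N N f f] and ffp = tensor_map_pure[OF M M N N f f]
  show ?thesis
    by (rule M.T2_eqI[OF module_hom_comp[OF bilinear_mapsD(1)[OF M.left_action_bilinear[OF m] x] ff]
          module_hom_comp[OF ff bilinear_mapsD(1)[OF N.left_action_bilinear[OF n] fx[OF x]]] _ u])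
       (simp add: x fx M.left_action_pure[OF m] N.left_action_pure[OF n] ffp bilinear_mapsD(3)[OF m] fm)
qed

lemma tensor_map_right_action:
  assumes M: "module R M" and N: "module R N" and f: "f \<in> module_hom R M N"
    and m: "m \<in> bilinear_maps R M M M" and n: "n \<in> bilinear_maps R N N N"
    and fm: "\<And>x. x \<in> carrier M \<Longrightarrow> f (m x y) = n (f x) (f y)"
    and y: "y \<in> carrier M" and u: "u \<in> carrier (tensor R M M)"
  shows "tensor_map R N N f f (right_action R M m y u) = right_action R N n (f y) (tensor_map R N N f f u)"
proof -
  interpret M: module R M by fact
  interpret N: module R N by fact
  note fx = module_hom_closed[OF f]
  note ff = tensor_map_hom[OF M M N N f f] and ffp = tensor_map_pure[OF M M N N f f]
  show ?thesis
    by (rule M.T2_eqI[OF module_hom_comp[OF bilinear_mapsD(1)[OF M.right_action_bilinear[OF m] y] ff]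
          module_hom_comp[OF ff bilinear_mapsD(1)[OF N.right_action_bilinear[OF n] fx[OF y]]] _ u])
       (simp add: y fx M.right_action_pure[OF m] N.right_action_pure[OF n] ffp bilinear_mapsD(3)[OF m] fm)
qed

section \<open>The bialgebra of planar binary trees\<close>

lemma HLR_sel:
  "carrier (HLR R) = carrier (free_module R UNIV)"
  "add (HLR R) = add (free_module R UNIV)"
  "zero (HLR R) = zero (free_module R UNIV)"
  "smult (HLR R) = smult (free_module R UNIV)"
  "mult (HLR R) = bilin_ext R under"
  "one (HLR R) = free_gen R Triv"
  by (simp_all add: HLR_def free_module_def)

lemma module_hom_HLR:
  "module_hom R (HLR R) P = module_hom R (free_module R UNIV) P"
  "module_hom R P (HLR R) = module_hom R P (free_module R UNIV)"
  by (simp_all only: module_hom_def HLR_sel)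

context cring
begin

abbreviation "F \<equiv> free_module R (UNIV :: pbtree set)"
abbreviation "gen \<equiv> free_gen R :: pbtree \<Rightarrow> _"

lemma module_F: "module R F"
  by (rule module_free_module) (rule is_cring)

lemma module_HLR: "module R (HLR R)"
  using module_F
  unfolding module_def abelian_group_def abelian_monoid_def abelian_group_axioms_def
    module_axioms_def HLR_sel .

lemma gen_closed: "gen T \<in> carrier (HLR R)"
  unfolding HLR_sel by (rule free_gen_carrier) (auto intro: is_cring)

lemma lin_ext_HLR_hom:
  "module R P \<Longrightarrow> (\<And>T. f T \<in> carrier P) \<Longrightarrow> lin_ext R P f \<in> module_hom R (HLR R) P"
  unfolding module_hom_HLR by (rule lin_ext_hom) auto

lemma HLR_linear_induct [consumes 1, case_names zero gen add smult]:
  assumes "c \<in> carrier (HLR R)"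
    and "P \<zero>\<^bsub>HLR R\<^esub>" and "\<And>T. P (gen T)"
    and "\<And>c d. c \<in> carrier (HLR R) \<Longrightarrow> d \<in> carrier (HLR R) \<Longrightarrow> P c \<Longrightarrow> P d \<Longrightarrow> P (c \<oplus>\<^bsub>HLR R\<^esub> d)"
    and "\<And>r c. r \<in> carrier R \<Longrightarrow> c \<in> carrier (HLR R) \<Longrightarrow> P c \<Longrightarrow> P (r \<odot>\<^bsub>HLR R\<^esub> c)"
  shows "P c"
  using is_cring assms(1) unfolding HLR_sel
  by (induction rule: free_module_induct) (use assms in \<open>simp_all only: HLR_sel\<close>)

lemma HLR_hom_eqI:
  assumes P: "module R P" and f: "f \<in> module_hom R (HLR R) P" and g: "g \<in> module_hom R (HLR R) P"
    and eq: "\<And>T. f (gen T) = g (gen T)" and c: "c \<in> carrier (HLR R)"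
  shows "f c = g c"
  using c
  by (induction rule: HLR_linear_induct)
     (simp_all add: eq module_hom_zero[OF module_HLR P f] module_hom_zero[OF module_HLR P g]
       module_hom_add[OF f] module_hom_add[OF g] module_hom_smult[OF f] module_hom_smult[OF g])

text \<open>Identities between bilinear operations on the module of trees can thus be read off from the
  recursions on trees.\<close>

lemma HLR_bilinear_eqI:
  assumes P: "module R P"
    and f: "f \<in> bilinear_maps R (HLR R) (HLR R) P" and g: "g \<in> bilinear_maps R (HLR R) (HLR R) P"
    and eq: "\<And>S T. f (gen S) (gen T) = g (gen S) (gen T)"
    and c: "c \<in> carrier (HLR R)" and d: "d \<in> carrier (HLR R)"
  shows "f c d = g c d"
proof (rule HLR_hom_eqI[OF P bilinear_mapsD(2)[OF f d] bilinear_mapsD(2)[OF g d] _ c])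
  fix S
  show "f (gen S) d = g (gen S) d"
    by (rule HLR_hom_eqI[OF P bilinear_mapsD(1)[OF f gen_closed] bilinear_mapsD(1)[OF g gen_closed] eq d])
qed

lemma bilin_ext_gen_left:
  "lin_ext R F (\<lambda>T. gen (f S T)) \<in> module_hom R (HLR R) (HLR R)"
  unfolding module_hom_HLR(2)
  by (rule lin_ext_HLR_hom[OF module_F]) (use gen_closed in \<open>simp add: HLR_sel\<close>)

text \<open>Linearity in the first argument is built into the outer linear extension. In the second argument
  it holds when the first one is a tree, and it passes to linear combinations.\<close>

lemma bilin_ext_bilinear: "bilin_ext R f \<in> bilinear_maps R (HLR R) (HLR R) (HLR R)"
proof -
  let ?G = "\<lambda>S. lin_ext R F (\<lambda>T. gen (f S T))"
  interpret H: module R "HLR R" by (rule module_HLR)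
  have G: "?G S b \<in> carrier F" if "b \<in> carrier (HLR R)" for S b
    using module_hom_closed[OF bilin_ext_gen_left that] by (simp add: HLR_sel)
  have left: "(\<lambda>a. bilin_ext R f a b) \<in> module_hom R (HLR R) (HLR R)" if b: "b \<in> carrier (HLR R)" for b
    unfolding bilin_ext_def Let_def module_hom_HLR(2)
    by (rule lin_ext_HLR_hom[OF module_F G[OF b]])
  have on_gen: "bilin_ext R f (gen S) b = ?G S b" if b: "b \<in> carrier (HLR R)" for S b
    unfolding bilin_ext_def Let_def by (rule lin_ext_gen, rule module_F, rule G[OF b])
  show ?thesis
  proof (rule bilinear_mapsI)
    fix a assume "a \<in> carrier (HLR R)"
    then show "bilin_ext R f a \<in> module_hom R (HLR R) (HLR R)"
    proof (induction rule: HLR_linear_induct)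
      case zero
      have "bilin_ext R f \<zero>\<^bsub>HLR R\<^esub> b = \<zero>\<^bsub>HLR R\<^esub>" if "b \<in> carrier (HLR R)" for b
        by (rule module_hom_zero[OF module_HLR module_HLR left[OF that]])
      then show ?case by (simp add: module_hom_def)
    next
      case (gen S)
      then show ?case
        using bilin_ext_gen_left[of f S] by (simp add: module_hom_def Pi_iff on_gen)
    next
      case (add c d)
      have "(\<lambda>b. bilin_ext R f c b \<oplus>\<^bsub>HLR R\<^esub> bilin_ext R f d b) \<in> module_hom R (HLR R) (HLR R)"
        by (rule module_hom_sum[OF module_HLR add(3,4)])
      then show ?case
        using add(1,2) by (simp add: module_hom_def Pi_iff left[THEN module_hom_add])
    next
      case (smult r c)
      have "(\<lambda>b. r \<odot>\<^bsub>HLR R\<^esub> bilin_ext R f c b) \<in> module_hom R (HLR R) (HLR R)"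
        using smult(1)
        by (intro module_homI)
          (simp_all add: module_hom_closed[OF smult(3)] module_hom_add[OF smult(3)]
            module_hom_smult[OF smult(3)] H.smult_r_distr H.smult_assoc1[symmetric] m_comm)
      then show ?case
        using smult(1,2) by (simp add: module_hom_def Pi_iff left[THEN module_hom_smult])
    qed
  qed (rule left)
qed

lemma bilin_ext_gen: "bilin_ext R f (gen S) (gen T) = gen (f S T)"
proof -
  have g: "gen T \<in> carrier F" for T using gen_closed by (simp add: HLR_sel)
  have "lin_ext R F (\<lambda>T. gen (f S T)) (gen T) \<in> carrier F" for S T
    using module_hom_closed[OF bilin_ext_gen_left gen_closed] by (simp add: HLR_sel)
  then show ?thesis
    unfolding bilin_ext_def Let_def by (simp add: lin_ext_gen[OF module_F] g)
qed

lemma HLR_vee_bilinear: "HLR_vee R \<in> bilinear_maps R (HLR R) (HLR R) (HLR R)"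
  and HLR_vee_gen: "HLR_vee R (gen S) (gen T) = gen (Graft S T)"
  and HLR_mult_bilinear: "(\<otimes>\<^bsub>HLR R\<^esub>) \<in> bilinear_maps R (HLR R) (HLR R) (HLR R)"
  and HLR_mult_gen: "gen S \<otimes>\<^bsub>HLR R\<^esub> gen T = gen (under S T)"
  by (simp_all add: HLR_vee_def HLR_sel bilin_ext_bilinear bilin_ext_gen)

lemma HLR_one: "\<one>\<^bsub>HLR R\<^esub> = gen Triv"
  by (simp add: HLR_sel)

lemma HLR_one_closed: "\<one>\<^bsub>HLR R\<^esub> \<in> carrier (HLR R)"
  by (simp add: HLR_one gen_closed)

text \<open>The module of trees is generated by the trivial tree under \<open>vee\<close> and linear combinations. So the
  bialgebra axioms and the statements on morphisms can be proved for arbitrary elements, by showing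
  that \<open>vee\<close> preserves them.\<close>

lemma HLR_induct [consumes 1, case_names one vee add smult]:
  assumes c: "c \<in> carrier (HLR R)"
    and one: "P \<one>\<^bsub>HLR R\<^esub>"
    and vee: "\<And>x y. x \<in> carrier (HLR R) \<Longrightarrow> y \<in> carrier (HLR R) \<Longrightarrow> P x \<Longrightarrow> P y \<Longrightarrow> P (HLR_vee R x y)"
    and add: "\<And>x y. x \<in> carrier (HLR R) \<Longrightarrow> y \<in> carrier (HLR R) \<Longrightarrow> P x \<Longrightarrow> P y \<Longrightarrow> P (x \<oplus>\<^bsub>HLR R\<^esub> y)"
    and smult: "\<And>r x. r \<in> carrier R \<Longrightarrow> x \<in> carrier (HLR R) \<Longrightarrow> P x \<Longrightarrow> P (r \<odot>\<^bsub>HLR R\<^esub> x)"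
  shows "P c"
  using c
proof (induction rule: HLR_linear_induct)
  case zero
  interpret H: module R "HLR R" by (rule module_HLR)
  have "P (\<zero> \<odot>\<^bsub>HLR R\<^esub> \<one>\<^bsub>HLR R\<^esub>)"
    by (rule smult[OF zero_closed HLR_one_closed one])
  then show ?case by (simp add: HLR_one_closed)
next
  case (gen T)
  show ?case
  proof (induction T)
    case Triv
    from one show ?case unfolding HLR_one .
  next
    case (Graft S T)
    then show ?case using vee[OF gen_closed gen_closed, of S T] by (simp add: HLR_vee_gen)
  qed
qed (fact add, fact smult)

text \<open>On trees this is the recursive clause of \<open>under\<close>.\<close>

lemma HLR_vee_mult:
  assumes x: "x \<in> carrier (HLR R)" and y: "y \<in> carrier (HLR R)" and z: "z \<in> carrier (HLR R)"
  shows "HLR_vee R x y \<otimes>\<^bsub>HLR R\<^esub> z = HLR_vee R x (y \<otimes>\<^bsub>HLR R\<^esub> z)"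
proof (rule HLR_bilinear_eqI[OF module_HLR _ _ _ x y])
  note mz = bilinear_mapsD(2)[OF HLR_mult_bilinear]
  show "(\<lambda>x y. HLR_vee R x y \<otimes>\<^bsub>HLR R\<^esub> z) \<in> bilinear_maps R (HLR R) (HLR R) (HLR R)"
    by (rule bilinear_maps_post_comp[OF HLR_vee_bilinear mz[OF z]])
  show "(\<lambda>x y. HLR_vee R x (y \<otimes>\<^bsub>HLR R\<^esub> z)) \<in> bilinear_maps R (HLR R) (HLR R) (HLR R)"
    using bilinear_maps_comp[OF HLR_vee_bilinear module_hom_id mz[OF z]] by simp
  fix S T
  show "HLR_vee R (gen S) (gen T) \<otimes>\<^bsub>HLR R\<^esub> z = HLR_vee R (gen S) (gen T \<otimes>\<^bsub>HLR R\<^esub> z)"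
  proof (rule HLR_hom_eqI[OF module_HLR _ _ _ z])
    show "(\<lambda>z. HLR_vee R (gen S) (gen T) \<otimes>\<^bsub>HLR R\<^esub> z) \<in> module_hom R (HLR R) (HLR R)"
      by (intro bilinear_mapsD(1)[OF HLR_mult_bilinear] bilinear_mapsD(3)[OF HLR_vee_bilinear] gen_closed)
    show "(\<lambda>z. HLR_vee R (gen S) (gen T \<otimes>\<^bsub>HLR R\<^esub> z)) \<in> module_hom R (HLR R) (HLR R)"
      by (rule module_hom_comp[OF bilinear_mapsD(1)[OF HLR_mult_bilinear gen_closed]
            bilinear_mapsD(1)[OF HLR_vee_bilinear gen_closed]])
  qed (simp add: HLR_vee_gen HLR_mult_gen)
qed

lemma HLR_one_mult: "x \<in> carrier (HLR R) \<Longrightarrow> \<one>\<^bsub>HLR R\<^esub> \<otimes>\<^bsub>HLR R\<^esub> x = x"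
  using HLR_hom_eqI[OF module_HLR bilinear_mapsD(1)[OF HLR_mult_bilinear gen_closed] module_hom_id, of Triv x]
  by (simp add: HLR_mult_gen HLR_one)

lemmas HLR_mult_closed = bilinear_mapsD(3)[OF HLR_mult_bilinear]

lemma HLR_mult_one: "x \<in> carrier (HLR R) \<Longrightarrow> x \<otimes>\<^bsub>HLR R\<^esub> \<one>\<^bsub>HLR R\<^esub> = x"
proof (induction rule: HLR_induct)
  case one
  then show ?case by (simp add: HLR_one HLR_mult_gen)
qed (simp_all add: HLR_vee_mult bilinear_maps_linear[OF HLR_mult_bilinear] HLR_one gen_closed)

lemma HLR_mult_assoc:
  assumes "x \<in> carrier (HLR R)" "y \<in> carrier (HLR R)" "z \<in> carrier (HLR R)"
  shows "x \<otimes>\<^bsub>HLR R\<^esub> y \<otimes>\<^bsub>HLR R\<^esub> z = x \<otimes>\<^bsub>HLR R\<^esub> (y \<otimes>\<^bsub>HLR R\<^esub> z)"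
  using assms(1)
proof (induction rule: HLR_induct)
  case one
  then show ?case using assms by (simp add: HLR_one_mult HLR_mult_closed)
qed (simp_all add: assms HLR_mult_closed HLR_vee_mult bilinear_maps_linear[OF HLR_mult_bilinear])

lemma HLR_under_vee_algebra: "unitary_under_vee_algebra R (HLR R) (HLR_vee R)"
proof -
  interpret H: module R "HLR R" by (rule module_HLR)
  have "ring (HLR R)"
    by (rule ringI)
       (auto intro!: H.M.abelian_group_axioms monoidI simp: HLR_mult_closed HLR_one_mult HLR_mult_one
         HLR_mult_assoc bilinear_maps_linear[OF HLR_mult_bilinear] HLR_one_closed)
  then show ?thesis
    by (intro unitary_under_vee_algebra.intro unitary_algebra.intro module_HLR
        unitary_algebra_axioms.intro unitary_under_vee_algebra_axioms.intro)
       (simp_all add: bilinear_maps_linear[OF HLR_mult_bilinear] HLR_vee_bilinear HLR_vee_mult)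
qed

abbreviation "TH \<equiv> tensor R (HLR R) (HLR R)"

lemma tree_coproduct_closed: "tree_coproduct R T \<in> carrier TH"
proof -
  interpret H: module R "HLR R" by (rule module_HLR)
  interpret T: module R TH by (rule H.mods)
  show ?thesis
  proof (induction T)
    case (Graft S T)
    then show ?case
      by (simp add: H.vee_coproduct_eq[OF HLR_vee_bilinear] gen_closed
          pure_tensor_closed[OF module_HLR module_HLR]
          bilinear_mapsD(3)[OF H.left_action_bilinear[OF HLR_vee_bilinear]]
          bilinear_mapsD(3)[OF H.right_action_bilinear[OF HLR_vee_bilinear]])
  qed simp
qed

lemma HLR_coproduct_hom: "HLR_coproduct R \<in> module_hom R (HLR R) TH"
  unfolding HLR_coproduct_def
  by (rule lin_ext_HLR_hom[OF module_tensor[OF module_HLR module_HLR] tree_coproduct_closed])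

lemma HLR_coproduct_gen: "HLR_coproduct R (gen T) = tree_coproduct R T"
  unfolding HLR_coproduct_def
  by (rule lin_ext_gen, rule module_tensor[OF module_HLR module_HLR], rule tree_coproduct_closed)

lemma HLR_coproduct_one: "HLR_coproduct R \<one>\<^bsub>HLR R\<^esub> = \<zero>\<^bsub>TH\<^esub>"
  by (simp add: HLR_one HLR_coproduct_gen)

text \<open>Both sides of the rule for \<open>\<Delta> (vee x y)\<close> are bilinear in \<open>x\<close> and \<open>y\<close>, and on trees the rule
  is the recursion that defines \<open>tree_coproduct\<close>.\<close>

lemma HLR_under_vee_coproduct: "under_vee_coproduct R (HLR R) (HLR_vee R) (HLR_coproduct R)"
proof -
  interpret H: unitary_under_vee_algebra R "HLR R" "HLR_vee R" by (rule HLR_under_vee_algebra)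
  note closed = module_hom_closed[OF HLR_coproduct_hom]
  note graft_right = H.right_action_bilinear[OF HLR_vee_bilinear]
    and graft_left = H.left_action_bilinear[OF HLR_vee_bilinear]
  have "HLR_coproduct R (HLR_vee R x y) = vee_coproduct R (HLR R) (HLR_vee R) x y (HLR_coproduct R x) (HLR_coproduct R y)"
    if x: "x \<in> carrier (HLR R)" and y: "y \<in> carrier (HLR R)" for x y
  proof -
    have "(\<lambda>x y. right_action R (HLR R) (HLR_vee R) y (HLR_coproduct R x)) \<in> bilinear_maps R (HLR R) (HLR R) TH"
      using bilinear_maps_comp[OF graft_right module_hom_id HLR_coproduct_hom] by (simp add: bilinear_maps_def)
    moreover have "(\<lambda>x y. left_action R (HLR R) (HLR_vee R) x (HLR_coproduct R y)) \<in> bilinear_maps R (HLR R) (HLR R) TH"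
      using bilinear_maps_comp[OF graft_left module_hom_id HLR_coproduct_hom] by simp
    ultimately have sum: "(\<lambda>x y. pure_tensor R (HLR R) (HLR R) x y
        \<oplus>\<^bsub>TH\<^esub> right_action R (HLR R) (HLR_vee R) y (HLR_coproduct R x)
        \<oplus>\<^bsub>TH\<^esub> left_action R (HLR R) (HLR_vee R) x (HLR_coproduct R y)) \<in> bilinear_maps R (HLR R) (HLR R) TH"
      by (intro bilinear_maps_sum H.mods(2) H.pure_bilinear)
    have "HLR_coproduct R (HLR_vee R x y) = pure_tensor R (HLR R) (HLR R) x y
        \<oplus>\<^bsub>TH\<^esub> right_action R (HLR R) (HLR_vee R) y (HLR_coproduct R x)
        \<oplus>\<^bsub>TH\<^esub> left_action R (HLR R) (HLR_vee R) x (HLR_coproduct R y)"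
      by (rule HLR_bilinear_eqI[OF H.mods(2) bilinear_maps_post_comp[OF HLR_vee_bilinear HLR_coproduct_hom] sum _ x y])
         (simp add: HLR_vee_gen HLR_coproduct_gen H.vee_coproduct_eq[OF HLR_vee_bilinear] gen_closed
           tree_coproduct_closed)
    then show ?thesis
      using x y by (simp add: H.vee_coproduct_eq[OF HLR_vee_bilinear] closed)
  qed
  then show ?thesis
    by unfold_locales (rule HLR_coproduct_hom)
qed

lemma HLR_bialgebra:
  "unitary_infinitesimal_under_vee_bialgebra R (HLR R) (HLR_coproduct R) (HLR_vee R)"
proof -
  interpret H: under_vee_coproduct R "HLR R" "HLR_vee R" "HLR_coproduct R"
    by (rule HLR_under_vee_coproduct)
  interpret T2: module R TH by (rule H.mods)
  interpret T3: module R "tensor R (HLR R) TH" by (rule H.mods)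
  note \<Delta> = HLR_coproduct_hom
  have coassoc: "H.coproduct_left (HLR_coproduct R x) = H.coproduct_right (HLR_coproduct R x)"
    if "x \<in> carrier (HLR R)" for x
    using that
  proof (induction rule: HLR_induct)
    case one
    show ?case
      using module_hom_zero[OF H.mods(2,3) H.coproduct_left_hom] module_hom_zero[OF H.mods(2,3) H.coproduct_right_hom]
      by (simp add: HLR_coproduct_one)
  next
    case (vee x y)
    then show ?case by (rule H.coassociative_graft)
  qed (simp_all add: module_hom_add[OF \<Delta>] module_hom_smult[OF \<Delta>] module_hom_closed[OF \<Delta>]
      module_hom_add[OF H.coproduct_left_hom] module_hom_add[OF H.coproduct_right_hom]
      module_hom_smult[OF H.coproduct_left_hom] module_hom_smult[OF H.coproduct_right_hom])
  have leibniz: "HLR_coproduct R (a \<otimes>\<^bsub>HLR R\<^esub> b) =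
      H.lmul a (HLR_coproduct R b) \<oplus>\<^bsub>TH\<^esub> H.rmul b (HLR_coproduct R a)"
    if a: "a \<in> carrier (HLR R)" and b: "b \<in> carrier (HLR R)" for a b
    using a
  proof (induction rule: HLR_induct)
    case one
    have "H.rmul b \<zero>\<^bsub>TH\<^esub> = \<zero>\<^bsub>TH\<^esub>"
      by (rule module_hom_zero[OF H.mods(2,2) bilinear_mapsD(1)[OF H.right_mult_bilinear b]])
    moreover have "H.lmul \<one>\<^bsub>HLR R\<^esub> u = u" if "u \<in> carrier TH" for u
      by (rule H.T2_eqI[OF bilinear_mapsD(1)[OF H.left_mult_bilinear HLR_one_closed]
            module_hom_id _ that, simplified])
         (simp add: H.left_mult_pure HLR_one_closed HLR_one_mult)
    ultimately show ?case
      using b by (simp add: HLR_one_mult HLR_coproduct_one module_hom_closed[OF \<Delta>])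
  next
    case (vee x y)
    then show ?case using b by (intro H.leibniz_graft)
  next
    case (add x y)
    then show ?case
      using b by (simp add: module_hom_add[OF \<Delta>] module_hom_closed[OF \<Delta>] HLR_mult_closed
          bilinear_maps_linear[OF HLR_mult_bilinear] bilinear_maps_linear(1)[OF H.left_mult_bilinear]
          bilinear_maps_linear(2)[OF H.right_mult_bilinear] H.left_mult_closed H.right_mult_closed T2.M.a_ac)
  next
    case (smult r x)
    then show ?case
      using b by (simp add: module_hom_smult[OF \<Delta>] module_hom_closed[OF \<Delta>] HLR_mult_closed
          bilinear_maps_linear[OF HLR_mult_bilinear] bilinear_maps_linear(3)[OF H.left_mult_bilinear]
          bilinear_maps_linear(4)[OF H.right_mult_bilinear] H.left_mult_closed H.right_mult_closed
          T2.smult_r_distr)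
  qed
  show ?thesis
  proof (intro unitary_infinitesimal_under_vee_bialgebra.intro unitary_infinitesimal_bialgebra.intro
      unitary_infinitesimal_bialgebra_axioms.intro HLR_under_vee_algebra HLR_coproduct_hom
      unitary_infinitesimal_under_vee_bialgebra_axioms.intro)
    show "unitary_algebra R (HLR R)" by unfold_locales
  qed (use coassoc leibniz H.coproduct_vee in
      \<open>simp_all add: H.coproduct_left_def H.coproduct_right_def left_action_def right_action_def\<close>)
qed

end

section \<open>The universal property\<close>

primrec tree_fold :: "'a \<Rightarrow> ('a \<Rightarrow> 'a \<Rightarrow> 'a) \<Rightarrow> pbtree \<Rightarrow> 'a" where
  "tree_fold e m Triv = e"
| "tree_fold e m (Graft S T) = m (tree_fold e m S) (tree_fold e m T)"

text \<open>Preservation of the unit and of \<open>vee\<close> forces preservation of the product and of the coproduct,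
  because on both sides \<open>vee\<close> determines these two operations in the same way, starting from
  \<open>1 * y = y\<close> and \<open>\<Delta> 1 = 0\<close>.\<close>

lemma under_vee_bialgebra_homI:
  assumes H: "unitary_infinitesimal_under_vee_bialgebra R H \<Delta> vee"
    and f: "f \<in> module_hom R (HLR R) H"
    and f_one: "f \<one>\<^bsub>HLR R\<^esub> = \<one>\<^bsub>H\<^esub>"
    and f_vee: "\<And>x y. x \<in> carrier (HLR R) \<Longrightarrow> y \<in> carrier (HLR R) \<Longrightarrow> f (HLR_vee R x y) = vee (f x) (f y)"
  shows "f \<in> under_vee_bialgebra_hom R (HLR R) (HLR_coproduct R) (HLR_vee R) H \<Delta> vee"
proof -
  interpret H: unitary_infinitesimal_under_vee_bialgebra R H \<Delta> vee by fact
  interpret H': under_vee_coproduct R H vee \<Delta> by (rule under_vee_bialgebra_coproduct[OF H])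
  interpret L: under_vee_coproduct R "HLR R" "HLR_vee R" "HLR_coproduct R"
    by (rule H.R.HLR_under_vee_coproduct)
  note mL = H.R.module_HLR and mH = H.mods(1)
  note fc = module_hom_closed[OF f]
  have mult: "f (x \<otimes>\<^bsub>HLR R\<^esub> y) = f x \<otimes>\<^bsub>H\<^esub> f y"
    if x: "x \<in> carrier (HLR R)" and y: "y \<in> carrier (HLR R)" for x y
    using x
  proof (induction rule: H.R.HLR_induct)
    case one
    then show ?case using y by (simp add: f_one fc)
  next
    case (vee a b)
    then show ?case
      using y by (simp add: L.vee_mult f_vee H.R.HLR_mult_closed fc H.vee_mult)
  next
    case (add a b)
    then show ?case
      using y by (simp add: bilinear_maps_linear(1)[OF L.mult_bilinear] module_hom_add[OF f] fc
          bilinear_maps_linear(1)[OF H'.mult_bilinear] H.R.HLR_mult_closed)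
  next
    case (smult r a)
    then show ?case
      using y by (simp add: bilinear_maps_linear(3)[OF L.mult_bilinear] module_hom_smult[OF f] fc
          bilinear_maps_linear(3)[OF H'.mult_bilinear] H.R.HLR_mult_closed)
  qed
  have ff: "tensor_map R H H f f \<in> module_hom R (tensor R (HLR R) (HLR R)) (tensor R H H)"
    by (rule tensor_map_hom[OF mL mL mH mH f f])
  have coproduct: "tensor_map R H H f f (HLR_coproduct R x) = \<Delta> (f x)" if "x \<in> carrier (HLR R)" for x
    using that
  proof (induction rule: H.R.HLR_induct)
    case one
    show ?case
      using module_hom_zero[OF L.mods(2) H.mods(2) ff]
      by (simp add: H.R.HLR_coproduct_one f_one H.coproduct_one)
  next
    case (vee x y)
    note L.graft_right_closed[simp] L.graft_left_closed[simp] L.coproduct_closed[simp] fc[simp]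
    have "tensor_map R H H f f (L.graft_right y (HLR_coproduct R x)) = H'.graft_right (f y) (\<Delta> (f x))"
      "tensor_map R H H f f (L.graft_left x (HLR_coproduct R y)) = H'.graft_left (f x) (\<Delta> (f y))"
      using vee by (simp_all add: f_vee
          tensor_map_right_action[OF mL mH f L.vee_bilinear H.vee_bilinear]
          tensor_map_left_action[OF mL mH f L.vee_bilinear H.vee_bilinear])
    moreover have "tensor_map R H H f f (pure_tensor R (HLR R) (HLR R) x y) = pure_tensor R H H (f x) (f y)"
      by (rule tensor_map_pure[OF mL mL mH mH f f vee(1,2)])
    ultimately show ?case
      using vee(1,2) by (simp add: L.coproduct_graft f_vee H'.coproduct_graft module_hom_add[OF ff]
          L.T2_add_closed pure_tensor_closed[OF mL mL])
  next
    case (add x y)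
    then show ?case
      by (simp add: module_hom_add[OF f] module_hom_add[OF ff] L.coproduct_closed fc
          module_hom_add[OF L.coproduct_linear] module_hom_add[OF H.coproduct_linear])
  next
    case (smult r x)
    then show ?case
      by (simp add: module_hom_smult[OF f] module_hom_smult[OF ff] L.coproduct_closed fc
          module_hom_smult[OF L.coproduct_linear] module_hom_smult[OF H.coproduct_linear])
  qed
  show ?thesis
    using f f_one f_vee mult coproduct by (simp add: under_vee_bialgebra_hom_def)
qed

text \<open>Existence: evaluate a tree in \<open>H\<close>, reading leaves as the unit and grafting as \<open>vee\<close>. Uniqueness:
  the trivial tree and \<open>vee\<close> generate.\<close>

lemma HLR_initial:
  assumes H: "unitary_infinitesimal_under_vee_bialgebra R H \<Delta> vee"
  shows "\<exists>!\<Phi>. \<Phi> \<in> extensional (carrier (HLR R)) \<and>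
    \<Phi> \<in> under_vee_bialgebra_hom R (HLR R) (HLR_coproduct R) (HLR_vee R) H \<Delta> vee"
proof -
  interpret H: unitary_infinitesimal_under_vee_bialgebra R H \<Delta> vee by fact
  interpret H': under_vee_coproduct R H vee \<Delta> by (rule under_vee_bialgebra_coproduct[OF H])
  interpret L: under_vee_coproduct R "HLR R" "HLR_vee R" "HLR_coproduct R"
    by (rule H.R.HLR_under_vee_coproduct)
  note mH = H.mods(1)
  let ?\<phi> = "tree_fold \<one>\<^bsub>H\<^esub> vee"
  have \<phi>: "?\<phi> T \<in> carrier H" for T
    by (induction T) (simp_all add: H'.vee_closed)
  define \<Phi> where "\<Phi> = restrict (lin_ext R H ?\<phi>) (carrier (HLR R))"
  have \<Phi>_ext: "\<Phi> \<in> extensional (carrier (HLR R))"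
    by (simp add: \<Phi>_def)
  have hom: "\<Phi> \<in> module_hom R (HLR R) H"
    using H.R.lin_ext_HLR_hom[OF mH \<phi>] by (simp add: \<Phi>_def module_hom_def Pi_iff)
  have gen: "\<Phi> (free_gen R T) = ?\<phi> T" for T
    unfolding \<Phi>_def using H.R.gen_closed lin_ext_gen[of R H ?\<phi> T, OF mH \<phi>] by simp
  have vee: "\<Phi> (HLR_vee R x y) = vee (\<Phi> x) (\<Phi> y)"
    if x: "x \<in> carrier (HLR R)" and y: "y \<in> carrier (HLR R)" for x y
    by (rule H.R.HLR_bilinear_eqI[OF mH bilinear_maps_post_comp[OF L.vee_bilinear hom]
          bilinear_maps_comp[OF H.vee_bilinear hom hom] _ x y])
       (simp add: H.R.HLR_vee_gen gen)
  have \<Phi>_one: "\<Phi> \<one>\<^bsub>HLR R\<^esub> = \<one>\<^bsub>H\<^esub>"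
    using gen[of Triv] by (simp add: H.R.HLR_one)
  show ?thesis
  proof (rule ex1I[of _ \<Phi>])
    show "\<Phi> \<in> extensional (carrier (HLR R)) \<and>
        \<Phi> \<in> under_vee_bialgebra_hom R (HLR R) (HLR_coproduct R) (HLR_vee R) H \<Delta> vee"
    proof
      show "\<Phi> \<in> extensional (carrier (HLR R))" by (rule \<Phi>_ext)
      show "\<Phi> \<in> under_vee_bialgebra_hom R (HLR R) (HLR_coproduct R) (HLR_vee R) H \<Delta> vee"
        by (rule under_vee_bialgebra_homI[OF H hom \<Phi>_one]) (rule vee)
    qed
  next
    fix \<Psi> assume "\<Psi> \<in> extensional (carrier (HLR R)) \<and>
        \<Psi> \<in> under_vee_bialgebra_hom R (HLR R) (HLR_coproduct R) (HLR_vee R) H \<Delta> vee"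
    then have ext: "\<Psi> \<in> extensional (carrier (HLR R))" and \<Psi>: "\<Psi> \<in> module_hom R (HLR R) H"
      and \<Psi>_one: "\<Psi> \<one>\<^bsub>HLR R\<^esub> = \<one>\<^bsub>H\<^esub>"
      and \<Psi>_vee: "\<And>x y. x \<in> carrier (HLR R) \<Longrightarrow> y \<in> carrier (HLR R) \<Longrightarrow>
        \<Psi> (HLR_vee R x y) = vee (\<Psi> x) (\<Psi> y)"
      by (auto simp: under_vee_bialgebra_hom_def)
    have "\<Psi> x = \<Phi> x" if "x \<in> carrier (HLR R)" for x
      using that
    proof (induction rule: H.R.HLR_induct)
      case one
      show ?case by (simp add: \<Psi>_one \<Phi>_one)
    qed (simp_all add: \<Psi>_vee vee module_hom_add[OF \<Psi>] module_hom_add[OF hom]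
        module_hom_smult[OF \<Psi>] module_hom_smult[OF hom])
    then show "\<Psi> = \<Phi>"
      by (rule extensionalityI[OF ext \<Phi>_ext])
  qed
qed

theorem theorem3p10:
  fixes R :: "('r, 'm) ring_scheme"
  assumes "cring R"
  shows "unitary_infinitesimal_under_vee_bialgebra R (HLR R) (HLR_coproduct R) (HLR_vee R)
    \<and> (\<forall>(H :: ('r, 'h, 'n) module_scheme) \<Delta> vee.
         unitary_infinitesimal_under_vee_bialgebra R H \<Delta> vee \<longrightarrow>
         (\<exists>!\<Phi>. \<Phi> \<in> extensional (carrier (HLR R)) \<and>
               \<Phi> \<in> under_vee_bialgebra_hom R (HLR R) (HLR_coproduct R) (HLR_vee R) H \<Delta> vee))"
  using cring.HLR_bialgebra[OF assms] HLR_initial by blast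

end
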